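(* Let $d\ge3$, let $(X,\mu)$ be an ergodic probability-measure-preserving action of $\mathrm{ASL}_d(\mathbb Z)$, and let $U\subset X$ be a positive measure $\mathrm{SL}_d(\mathbb Z)$-invariant subset. Suppose that the action of $\mathbb Z^d$ on $(X,\mu)$ is weakly mixing. Then for every finite subset $F\subset\mathbb Z^d$, $$\mu\Bigl(\bigcap_{t\in F}tU\Bigr)=\mu(U)^{|F|}.$$
   Context: $\mathrm{ASL}_d(\mathbb Z)=\mathrm{SL}_d(\mathbb Z)\ltimes\mathbb Z^d$ is the group of affine maps $t\mapsto\gamma_0t+v$ of $\mathbb Z^d$, with $\gamma_0\in \mathrm{SL}_d(\mathbb Z)$ and $v\in\mathbb Z^d$; $\mathbb Z^d$ is its translation subgroup, $\mathrm{SL}_d(\mathbb Z)$ the stabiliser of $0$. $X$ is a standard Borel space, $\mu$ a Borel probability measure, and $tU$ denotes the image of $U$ under $t\in\mathbb Z^d\subset \mathrm{ASL}_d(\mathbb Z)$. *)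

theory Defs
  imports "HOL-Probability.Probability" "HOL-Algebra.Group_Action"
begin

text \<open>The index type \<open>'d\<close> plays the role of \<open>{1, \<dots>, d}\<close>, so \<open>\<int>\<^sup>d\<close> is \<open>int ^ 'd\<close> with
  \<open>d = CARD('d)\<close>. Elements of the affine group are the affine maps themselves.\<close>

definition affine_map :: "int ^ 'd ^ 'd \<Rightarrow> int ^ 'd \<Rightarrow> int ^ 'd \<Rightarrow> int ^ 'd"
  where "affine_map A v = (\<lambda>t. A *v t + v)"

definition ASL :: "(int ^ 'd \<Rightarrow> int ^ 'd) monoid"
  where "ASL = \<lparr>carrier = {affine_map A v | A v. det A = 1}, mult = (\<circ>), one = id\<rparr>"

definition SL :: "(int ^ 'd \<Rightarrow> int ^ 'd) set"
  where "SL = {affine_map A 0 | A. det A = 1}"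

definition translation :: "int ^ 'd \<Rightarrow> int ^ 'd \<Rightarrow> int ^ 'd"
  where "translation v = affine_map (mat 1) v"

definition standard_borel_space :: "'a measure \<Rightarrow> bool"
  where "standard_borel_space M \<longleftrightarrow>
    (\<exists>T. completely_metrizable_space T \<and> second_countable T \<and>
         space M = topspace T \<and> sets M = sigma_sets (topspace T) {W. openin T W})"

definition pmp_action :: "('g, 'b) monoid_scheme \<Rightarrow> 'a measure \<Rightarrow> ('g \<Rightarrow> 'a \<Rightarrow> 'a) \<Rightarrow> bool"
  where "pmp_action G M \<phi> \<longleftrightarrow>
    prob_space M \<and> group_action G (space M) \<phi> \<and>
    (\<forall>g\<in>carrier G. \<phi> g \<in> M \<rightarrow>\<^sub>M M \<and> distr M M (\<phi> g) = M)"

text \<open>Both notions are for the restriction of an action to the set (subgroup) \<open>H\<close> of group elements.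
  Weak mixing is ergodicity of the diagonal action on the product space.\<close>

definition ergodic_on :: "'g set \<Rightarrow> 'a measure \<Rightarrow> ('g \<Rightarrow> 'a \<Rightarrow> 'a) \<Rightarrow> bool"
  where "ergodic_on H M \<phi> \<longleftrightarrow>
    (\<forall>A\<in>sets M. (\<forall>h\<in>H. \<phi> h ` A = A) \<longrightarrow> measure M A = 0 \<or> measure M A = 1)"

definition weakly_mixing_on :: "'g set \<Rightarrow> 'a measure \<Rightarrow> ('g \<Rightarrow> 'a \<Rightarrow> 'a) \<Rightarrow> bool"
  where "weakly_mixing_on H M \<phi> \<longleftrightarrow>
    ergodic_on H (M \<Otimes>\<^sub>M M) (\<lambda>h. map_prod (\<phi> h) (\<phi> h))"

end

theory Submission
  imports Defs
begin

text \<open>Write \<open>g\<close> for the centred indicator of \<open>U\<close> and \<open>g\<^sub>t\<close> for its translate by \<open>t \<in> \<int>\<^sup>d\<close>. Expanding the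
product of the functions \<open>g\<^sub>t + \<mu>(U)\<close>, the theorem amounts to the vanishing of every correlation
\<open>\<integral> \<Prod>t\<in>V. g\<^sub>t\<close> with \<open>V\<close> finite and nonempty. Since \<open>U\<close> is \<open>SL\<^sub>d(\<int>)\<close>-invariant, such a correlation does
not change when \<open>V\<close> is moved by a matrix of determinant one. The proof averages over suitable
families of matrices and shows that the averages tend to zero.

The averages are controlled by \<open>van_der_Corput_average\<close>: if the \<open>f\<^sub>i\<close> are bounded and move with
integer speeds \<open>a\<^sub>i\<close>, the mean of \<open>\<integral> \<Prod>i. f\<^sub>i(a\<^sub>i x \<cdot> y) dy\<close> over \<open>x\<close> in large cubes tends to zero as
soon as one \<open>f\<^sub>j\<close>, whose speed differs from all others, belongs to a \<^emph>\<open>decorrelating\<close> class: a class of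
mean zero functions in which a product of two translates is again in the class up to an error that
is small on average. This is Furstenberg's argument for multiple weak mixing, with the
mixing property imposed on a class of functions instead of on the action. When \<open>\<int>\<^sup>d\<close> is weakly mixing, all
bounded mean zero functions form such a class (\<open>weakly_mixing_decorrelating\<close>). This does not
apply directly to translations along one fixed direction, because a single direction need
not act ergodically on \<open>X\<close>. Points on a line are therefore treated separately.

\<^item> Collinear points (\<open>collinear_correlation_zero\<close>). For a finite set \<open>S\<close> of integers, the correlation of
  the points \<open>n x\<close>, \<open>n \<in> S\<close>, depends only on the \<open>SL\<^sub>d(\<int>)\<close>-orbit of \<open>x\<close>, hence only on the greatest common
  divisor \<open>c\<close> of the coordinates of \<open>x\<close> (\<open>SL_orbit_axis\<close>); call it \<open>\<Psi>(c)\<close>. Averaging over all \<open>x\<close>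
  of a cube gives zero in the limit, by weak mixing of \<open>\<int>\<^sup>d\<close>. But at least three quarters of the vectors
  in a cube have \<open>c = 1\<close>, so \<open>\<Psi>(1)\<close> cannot be larger than a third of the supremum of \<open>\<bar>\<Psi>\<bar>\<close>. The same
  holds with \<open>x\<close> replaced by \<open>m x\<close>, for \<open>\<Psi>(m)\<close>. Hence the supremum is zero.

\<^item> Arbitrary points (\<open>correlation_zero\<close>). The shears \<open>t \<mapsto> t + n \<phi>(t) e\<^sub>k\<close> move the points of \<open>V\<close> parallel to
  \<open>e\<^sub>k\<close>, with speeds \<open>\<phi>(t)\<close> that differ for points on different lines parallel to \<open>e\<^sub>k\<close>, if the functional
  \<open>\<phi>\<close> is generic. By the collinear case the products of \<open>g\<^sub>t\<close> over points of one such line have mean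
  zero. Two far apart translates of such a product along the line multiply to a product of the same kind, so
  these products form a decorrelating class for the translations along \<open>e\<^sub>k\<close>.\<close>

section \<open>Bounded measurable functions and finitely supported weights\<close>

definition bounded_measurable :: "'a measure \<Rightarrow> ('a \<Rightarrow> real) set"
  where "bounded_measurable M = {f \<in> borel_measurable M. \<exists>K. \<forall>x\<in>space M. \<bar>f x\<bar> \<le> K}"

lemma bounded_measurableI:
  "f \<in> borel_measurable M \<Longrightarrow> (\<And>x. x \<in> space M \<Longrightarrow> \<bar>f x\<bar> \<le> K) \<Longrightarrow> f \<in> bounded_measurable M"
  unfolding bounded_measurable_def by auto

lemma bounded_measurable_measurable:
  "f \<in> bounded_measurable M \<Longrightarrow> f \<in> borel_measurable M"
  unfolding bounded_measurable_def by auto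

lemma bounded_measurable_bound:
  assumes "f \<in> bounded_measurable M"
  obtains K where "K \<ge> 1" "\<And>x. x \<in> space M \<Longrightarrow> \<bar>f x\<bar> \<le> K"
proof -
  from assms obtain K where "\<forall>x\<in>space M. \<bar>f x\<bar> \<le> K" unfolding bounded_measurable_def by auto
  then show ?thesis using that[of "max K 1"] by force
qed

lemma bounded_measurable_const [simp]: "(\<lambda>_. k) \<in> bounded_measurable M"
  by (rule bounded_measurableI[of _ _ "\<bar>k\<bar>"]) auto

lemma bounded_measurable_add:
  assumes "f \<in> bounded_measurable M" "g \<in> bounded_measurable M"
  shows "(\<lambda>x. f x + g x) \<in> bounded_measurable M"
proof -
  obtain K L where "\<And>x. x \<in> space M \<Longrightarrow> \<bar>f x\<bar> \<le> K" "\<And>x. x \<in> space M \<Longrightarrow> \<bar>g x\<bar> \<le> L"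
    using bounded_measurable_bound[OF assms(1)] bounded_measurable_bound[OF assms(2)] by metis
  then have "\<bar>f x + g x\<bar> \<le> K + L" if "x \<in> space M" for x
    using that by (meson abs_triangle_ineq add_mono order_trans)
  moreover have "(\<lambda>x. f x + g x) \<in> borel_measurable M"
    using assms by (intro borel_measurable_add bounded_measurable_measurable)
  ultimately show ?thesis by (intro bounded_measurableI[where K = "K + L"])
qed

lemma bounded_measurable_mult:
  assumes "f \<in> bounded_measurable M" "g \<in> bounded_measurable M"
  shows "(\<lambda>x. f x * g x) \<in> bounded_measurable M"
proof -
  obtain K L where "\<And>x. x \<in> space M \<Longrightarrow> \<bar>f x\<bar> \<le> K" "\<And>x. x \<in> space M \<Longrightarrow> \<bar>g x\<bar> \<le> L"
    using bounded_measurable_bound[OF assms(1)] bounded_measurable_bound[OF assms(2)] by metis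
  then have "\<bar>f x * g x\<bar> \<le> K * L" if "x \<in> space M" for x
    using that unfolding abs_mult by (meson abs_ge_zero mult_mono order_trans)
  moreover have "(\<lambda>x. f x * g x) \<in> borel_measurable M"
    using assms by (intro borel_measurable_times bounded_measurable_measurable)
  ultimately show ?thesis by (intro bounded_measurableI[where K = "K * L"])
qed

lemma bounded_measurable_diff:
  assumes "f \<in> bounded_measurable M" "g \<in> bounded_measurable M"
  shows "(\<lambda>x. f x - g x) \<in> bounded_measurable M"
  using bounded_measurable_add[OF assms(1) bounded_measurable_mult[OF bounded_measurable_const[of "-1"] assms(2)]]
  by simp

lemma bounded_measurable_sum:
  "(\<And>i. i \<in> I \<Longrightarrow> f i \<in> bounded_measurable M) \<Longrightarrow> (\<lambda>x. \<Sum>i\<in>I. f i x) \<in> bounded_measurable M"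
  by (induction I rule: infinite_finite_induct) (auto intro: bounded_measurable_add)

lemma bounded_measurable_prod:
  "(\<And>i. i \<in> I \<Longrightarrow> f i \<in> bounded_measurable M) \<Longrightarrow> (\<lambda>x. \<Prod>i\<in>I. f i x) \<in> bounded_measurable M"
  by (induction I rule: infinite_finite_induct) (auto intro: bounded_measurable_mult)

lemma bounded_measurable_power:
  "f \<in> bounded_measurable M \<Longrightarrow> (\<lambda>x. f x ^ n) \<in> bounded_measurable M"
  by (induction n) (auto intro: bounded_measurable_mult)

lemma bounded_measurable_abs:
  assumes "f \<in> bounded_measurable M" shows "(\<lambda>x. \<bar>f x\<bar>) \<in> bounded_measurable M"
  using assms unfolding bounded_measurable_def by auto

lemma bounded_measurable_comp:
  assumes "f \<in> bounded_measurable N" "h \<in> M \<rightarrow>\<^sub>M N"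
  shows "(\<lambda>x. f (h x)) \<in> bounded_measurable M"
proof -
  obtain K where K: "\<And>x. x \<in> space N \<Longrightarrow> \<bar>f x\<bar> \<le> K"
    using bounded_measurable_bound[OF assms(1)] by metis
  then show ?thesis
    using assms(2) measurable_space[OF assms(2)] measurable_compose[OF assms(2) bounded_measurable_measurable[OF assms(1)]]
    by (intro bounded_measurableI[of _ _ K]) auto
qed

lemmas bounded_measurable_intros = bounded_measurable_const bounded_measurable_add
  bounded_measurable_diff bounded_measurable_mult bounded_measurable_sum bounded_measurable_prod
  bounded_measurable_power bounded_measurable_abs

lemma (in prob_space) bounded_measurable_integrable:
  assumes "f \<in> bounded_measurable M" shows "integrable M f"
proof -
  obtain K where K: "\<And>x. x \<in> space M \<Longrightarrow> \<bar>f x\<bar> \<le> K"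
    using bounded_measurable_bound[OF assms] by metis
  then show ?thesis
    using bounded_measurable_measurable[OF assms]
    by (intro integrable_const_bound[of _ K]) auto
qed

lemma (in prob_space) expectation_abs_le:
  assumes "f \<in> bounded_measurable M" "\<And>x. x \<in> space M \<Longrightarrow> \<bar>f x\<bar> \<le> K"
  shows "\<bar>expectation f\<bar> \<le> K"
proof -
  have "\<bar>expectation f\<bar> \<le> expectation (\<lambda>x. \<bar>f x\<bar>)" by (rule integral_abs_bound)
  also have "\<dots> \<le> expectation (\<lambda>x. K)"
    using assms by (intro integral_mono bounded_measurable_integrable bounded_measurable_intros) auto
  finally show ?thesis by (simp add: prob_space)
qed

lemma (in prob_space) expectation_square_le:
  assumes "f \<in> bounded_measurable M"
  shows "(expectation f)\<^sup>2 \<le> expectation (\<lambda>x. (f x)\<^sup>2)"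
  using variance_positive[of f] variance_eq[of f]
    bounded_measurable_integrable[OF assms] bounded_measurable_integrable[OF bounded_measurable_power[OF assms]]
  by simp

text \<open>A probability vector with finite support. Vanishing outside of \<open>S\<close> makes the midpoint of two weight
vectors on different sets a weight vector on the union.\<close>

definition weights :: "'v set \<Rightarrow> ('v \<Rightarrow> real) \<Rightarrow> bool"
  where "weights S c \<longleftrightarrow> finite S \<and> (\<forall>h. 0 \<le> c h) \<and> (\<forall>h. h \<notin> S \<longrightarrow> c h = 0) \<and> sum c S = 1"

lemma weights_midpoint:
  assumes "weights S c" "weights S' c'"
  shows "weights (S \<union> S') (\<lambda>h. (c h + c' h) / 2)"
    and "(\<Sum>h\<in>S \<union> S'. (c h + c' h) / 2 * F h) = ((\<Sum>h\<in>S. c h * F h) + (\<Sum>h\<in>S'. c' h * F h)) / 2"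
proof -
  have *: "(\<Sum>h\<in>S \<union> S'. (c h + c' h) / 2 * F h) = ((\<Sum>h\<in>S. c h * F h) + (\<Sum>h\<in>S'. c' h * F h)) / 2" for F
  proof -
    have "(\<Sum>h\<in>S. c h * F h) = (\<Sum>h\<in>S \<union> S'. c h * F h)" "(\<Sum>h\<in>S'. c' h * F h) = (\<Sum>h\<in>S \<union> S'. c' h * F h)"
      using assms unfolding weights_def by (auto intro!: sum.mono_neutral_left)
    then show ?thesis
      by (simp add: sum.distrib[symmetric] sum_divide_distrib algebra_simps add_divide_distrib)
  qed
  then show "(\<Sum>h\<in>S \<union> S'. (c h + c' h) / 2 * F h) = ((\<Sum>h\<in>S. c h * F h) + (\<Sum>h\<in>S'. c' h * F h)) / 2" .
  show "weights (S \<union> S') (\<lambda>h. (c h + c' h) / 2)"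
    using assms *[of "\<lambda>_. 1"] unfolding weights_def by auto
qed

section \<open>Actions of the lattice and the mean ergodic theorem\<close>

locale lattice_action = prob_space M for M :: "'a measure" +
  fixes T :: "int ^ 'd \<Rightarrow> 'a \<Rightarrow> 'a"
  assumes T_measurable [measurable]: "T v \<in> M \<rightarrow>\<^sub>M M"
    and T_preserves: "distr M M (T v) = M"
    and T_zero: "x \<in> space M \<Longrightarrow> T 0 x = x"
    and T_add: "x \<in> space M \<Longrightarrow> T (v + w) x = T v (T w x)"
begin

lemma T_space: "x \<in> space M \<Longrightarrow> T v x \<in> space M"
  using measurable_space[OF T_measurable] .

lemma bounded_measurable_T:
  "f \<in> bounded_measurable M \<Longrightarrow> (\<lambda>x. f (T v x)) \<in> bounded_measurable M"
  by (rule bounded_measurable_comp[OF _ T_measurable])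

lemma integral_T:
  fixes f :: "'a \<Rightarrow> real"
  assumes "f \<in> borel_measurable M"
  shows "expectation (\<lambda>x. f (T v x)) = expectation f"
proof -
  have "expectation f = integral\<^sup>L (distr M M (T v)) f" by (simp add: T_preserves)
  also have "\<dots> = expectation (\<lambda>x. f (T v x))" using assms by (rule integral_distr[OF T_measurable])
  finally show ?thesis ..
qed

lemma AE_T:
  assumes "AE x in M. P x" shows "AE x in M. P (T v x)"
proof -
  have "AE x in distr M M (T v). P x" using assms by (subst T_preserves)
  then show ?thesis by (rule AE_distrD[OF T_measurable])
qed

definition ergodic :: bool
  where "ergodic \<longleftrightarrow> (\<forall>A\<in>sets M. (\<forall>v. T v ` A = A) \<longrightarrow> prob A = 0 \<or> prob A = 1)"

text \<open>Ergodicity speaks of strictly invariant sets. An almost invariant set agrees almost everywhere with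
the set of points whose whole orbit lies in it, which is strictly invariant; countability of the
lattice makes this set measurable.\<close>

lemma AE_invariant_measure_0_1:
  assumes "ergodic" and [measurable]: "A \<in> sets M"
    and inv: "\<And>v. AE x in M. x \<in> A \<longleftrightarrow> T v x \<in> A"
  shows "prob A = 0 \<or> prob A = 1"
proof -
  have cnt: "countable (UNIV :: (int ^ 'd) set)"
  proof -
    have "inj (\<lambda>v::int^'d. (\<lambda>i. v $ i))" by (auto intro!: injI simp: vec_eq_iff fun_eq_iff)
    moreover have "countable (UNIV :: ('d \<Rightarrow> int) set)"
      using countable_PiE[of "UNIV :: 'd set" "\<lambda>_. UNIV :: int set"] by (simp add: PiE_UNIV_domain)
    ultimately show ?thesis by (meson countable_image_inj_on countable_subset subset_UNIV)
  qed
  define A' where "A' = {x \<in> space M. \<forall>v. T v x \<in> A}"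
  have A': "A' \<in> sets M"
  proof -
    have "{x \<in> space M. \<forall>v\<in>UNIV. T v x \<in> A} \<in> sets M"
      using cnt by (intro sets.sets_Collect_countable_Ball) measurable
    then show ?thesis by (simp add: A'_def)
  qed
  have sub: "T v ` A' \<subseteq> A'" for v
  proof
    fix y assume "y \<in> T v ` A'"
    then obtain x where "x \<in> A'" "y = T v x" by auto
    then show "y \<in> A'" by (auto simp: A'_def T_space T_add[symmetric])
  qed
  have "T v ` A' = A'" for v
  proof
    show "A' \<subseteq> T v ` A'"
    proof
      fix x assume "x \<in> A'"
      then have "T (-v) x \<in> A'" "x \<in> space M" using sub[of "-v"] by (auto simp: A'_def)
      moreover have "x = T v (T (-v) x)" using T_add[of x v "-v"] T_zero \<open>x \<in> space M\<close> by simp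
      ultimately show "x \<in> T v ` A'" by blast
    qed
  qed (rule sub)
  then have "prob A' = 0 \<or> prob A' = 1" using A' assms(1) unfolding ergodic_def by blast
  moreover have "AE x in M. x \<in> A \<longleftrightarrow> x \<in> A'"
  proof -
    have "AE x in M. \<forall>v\<in>UNIV. x \<in> A \<longleftrightarrow> T v x \<in> A" using inv by (subst AE_ball_countable[OF cnt]) blast
    then show ?thesis
      by (rule AE_mp[OF _ AE_I2]) (use T_zero in \<open>force simp: A'_def\<close>)
  qed
  then have "prob A = prob A'" using A' by (intro finite_measure_eq_AE) auto
  ultimately show ?thesis by simp
qed

lemma ergodic_AE_invariant_zero:
  assumes "ergodic" and f: "f \<in> bounded_measurable M" "expectation f = 0"
    and inv: "\<And>v. AE x in M. f (T v x) = f x"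
  shows "AE x in M. f x = 0"
proof -
  note [measurable] = bounded_measurable_measurable[OF f(1)]
  have nonpos: "AE x in M. f x \<le> 0" if f: "f \<in> bounded_measurable M" "expectation f = 0"
    and inv: "\<And>v. AE x in M. f (T v x) = f x" for f
  proof -
    note [measurable] = bounded_measurable_measurable[OF f(1)]
    define A where "A = {x \<in> space M. f x > 0}"
    have [measurable]: "A \<in> sets M" unfolding A_def by measurable
    have "AE x in M. x \<in> A \<longleftrightarrow> T v x \<in> A" for v
      using inv[of v] AE_space by eventually_elim (auto simp: A_def T_space)
    then consider "prob A = 0" | "prob A = 1"
      using AE_invariant_measure_0_1[OF assms(1) \<open>A \<in> sets M\<close>] by blast
    then show ?thesis
    proof cases
      case 1
      then have "AE x in M. x \<notin> A" by (simp add: prob_eq_0)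
      then show ?thesis using AE_space by eventually_elim (auto simp: A_def)
    next
      case 2
      then have pos: "AE x in M. f x > 0" using prob_eq_1[of A] by (auto simp: A_def elim: AE_mp)
      then have "AE x in M. f x = 0"
        using f integral_nonneg_eq_0_iff_AE[OF bounded_measurable_integrable[OF f(1)]]
        by (metis (mono_tags, lifting) AE_mp AE_I2 less_imp_le)
      then show ?thesis by eventually_elim simp
    qed
  qed
  have "AE x in M. f x \<le> 0" using nonpos f inv by blast
  moreover have "AE x in M. - f x \<le> 0"
    using f inv bounded_measurable_diff[OF bounded_measurable_const[of 0] f(1)] by (intro nonpos) auto
  ultimately show ?thesis by eventually_elim simp
qed

lemma weights_translate:
  assumes "weights S c"
  shows "weights ((\<lambda>h. h + v) ` S) (\<lambda>h. c (h - v))"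
    and "y \<in> space M \<Longrightarrow> (\<Sum>h\<in>S. c h * f (T h (T v y))) = (\<Sum>h\<in>(\<lambda>h. h + v) ` S. c (h - v) * f (T h y))"
proof -
  have *: "(\<Sum>h\<in>(\<lambda>h. h + v) ` S. c (h - v) * F h) = (\<Sum>h\<in>S. c h * F (h + v))" for F :: "int^'d \<Rightarrow> real"
    by (subst sum.reindex) (auto simp: inj_on_def)
  show "(\<Sum>h\<in>S. c h * f (T h (T v y))) = (\<Sum>h\<in>(\<lambda>h. h + v) ` S. c (h - v) * f (T h y))" if "y \<in> space M"
    unfolding * by (simp add: T_add that)
  have "h \<in> (\<lambda>h. h + v) ` S \<longleftrightarrow> h - v \<in> S" for h by (force simp: image_iff)
  then show "weights ((\<lambda>h. h + v) ` S) (\<lambda>h. c (h - v))"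
    using assms *[of "\<lambda>_. 1"] unfolding weights_def by auto
qed

text \<open>The inequality between the arithmetic and geometric mean, with weights chosen such that an \<open>L\<^sup>2\<close> bound
of order \<open>(1/4)\<^sup>n\<close> on the squares gives a summable \<open>L\<^sup>1\<close> bound.\<close>

lemma (in -) half_power_bound:
  fixes d :: real
  shows "\<bar>d\<bar> \<le> (2 ^ n * d\<^sup>2 + (1 / 2) ^ n) / 2"
proof -
  have "0 \<le> (1 / 2) ^ n * (2 ^ n * \<bar>d\<bar> - 1)\<^sup>2" by simp
  also have "\<dots> = 2 ^ n * d\<^sup>2 + (1 / 2) ^ n - 2 * \<bar>d\<bar>"
    by (simp add: power2_eq_square field_simps)
  finally show ?thesis by simp
qed

lemma AE_convergent_if_fast_Cauchy:
  fixes f :: "nat \<Rightarrow> 'a \<Rightarrow> real"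
  assumes f: "\<And>n. f n \<in> bounded_measurable M"
    and le: "\<And>n. expectation (\<lambda>x. (f (Suc n) x - f n x)\<^sup>2) \<le> B * (1 / 4) ^ n"
  shows "AE x in M. convergent (\<lambda>n. f n x)"
proof -
  define d where "d n x = \<bar>f (Suc n) x - f n x\<bar>" for n x
  have d: "d n \<in> bounded_measurable M" for n
    unfolding d_def by (intro bounded_measurable_intros f)
  note [measurable] = bounded_measurable_measurable[OF d]
  have Ed: "expectation (d n) \<le> (B + 1) / 2 * (1 / 2) ^ n" for n
  proof -
    have "expectation (d n) \<le> expectation (\<lambda>x. (2 ^ n * (f (Suc n) x - f n x)\<^sup>2 + (1 / 2) ^ n) / 2)"
      unfolding d_def divide_inverse
      by (intro integral_mono bounded_measurable_integrable bounded_measurable_intros f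
          half_power_bound[unfolded divide_inverse])
    also have "\<dots> = (2 ^ n * expectation (\<lambda>x. (f (Suc n) x - f n x)\<^sup>2) + (1 / 2) ^ n) / 2"
      by (simp add: prob_space bounded_measurable_integrable bounded_measurable_intros f)
    also have "\<dots> \<le> (2 ^ n * (B * (1 / 4) ^ n) + (1 / 2) ^ n) / 2"
      using le[of n] by (intro divide_right_mono add_mono mult_left_mono) auto
    also have "2 ^ n * (B * (1 / 4) ^ n) = B * (1 / 2 :: real) ^ n"
      by (simp add: power_mult_distrib[symmetric] flip: mult.assoc power_mult_distrib)
    finally show ?thesis by (simp add: algebra_simps)
  qed
  have "(\<integral>\<^sup>+x. (\<Sum>n. ennreal (d n x)) \<partial>M) = (\<Sum>n. \<integral>\<^sup>+x. ennreal (d n x) \<partial>M)"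
    by (intro nn_integral_suminf) measurable
  also have "\<dots> = (\<Sum>n. ennreal (expectation (d n)))"
    by (intro suminf_cong nn_integral_eq_integral bounded_measurable_integrable d) (auto simp: d_def)
  also have "\<dots> \<noteq> \<infinity>"
  proof -
    have "summable (\<lambda>n. (B + 1) / 2 * (1 / 2 :: real) ^ n)"
      by (intro summable_mult summable_geometric) auto
    moreover have "0 \<le> expectation (d n)" for n by (simp add: d_def)
    ultimately have "summable (\<lambda>n. expectation (d n))"
      using Ed by - (rule summable_comparison_test'[where N = 0], assumption, simp only: real_norm_def abs_of_nonneg)
    then show ?thesis using \<open>\<And>n. 0 \<le> expectation (d n)\<close>
      by (simp add: suminf_ennreal2)
  qed
  finally have "AE x in M. (\<Sum>n. ennreal (d n x)) \<noteq> \<infinity>"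
    by (intro nn_integral_noteq_infinite) auto
  then show ?thesis
  proof eventually_elim
    case (elim x)
    then have "summable (\<lambda>n. d n x)"
      by (intro summable_suminf_not_top) (auto simp: d_def)
    then have "summable (\<lambda>n. f (Suc n) x - f n x)"
      unfolding d_def by (rule summable_rabs_cancel)
    then have "convergent (\<lambda>m. f m x - f 0 x)"
      by (simp add: summable_iff_convergent sum_lessThan_telescope[of "\<lambda>n. f n x"])
    then have "convergent (\<lambda>m. (f m x - f 0 x) + f 0 x)"
      by (intro convergent_add convergent_const)
    then show ?case by simp
  qed
qed

text \<open>A form of von Neumann's mean ergodic theorem: the closed convex hull of the orbit of \<open>F\<close> contains \<open>0\<close>.
By the parallelogram law, convex combinations \<open>f\<^sub>n\<close> whose \<open>L\<^sup>2\<close> norms approach the infimum over the hull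
form a Cauchy sequence. The same law applied to \<open>f\<^sub>n\<close> and a translate of \<open>f\<^sub>n\<close> shows that the limit is
invariant. Invariant functions of mean zero vanish by ergodicity, so the infimum is zero. The sequence
is chosen to converge fast enough for pointwise convergence almost everywhere.\<close>

proposition ergodic_mean_small:
  assumes "ergodic" and F: "F \<in> bounded_measurable M" "expectation F = 0" and "\<epsilon> > 0"
  obtains S c where "weights S c" "expectation (\<lambda>x. (\<Sum>h\<in>S. c h * F (T h x))\<^sup>2) < \<epsilon>"
proof -
  define C where "C = {f. \<exists>S c. weights S c \<and> f = (\<lambda>x. \<Sum>h\<in>S. c h * F (T h x))}"
  define E :: "('a \<Rightarrow> real) \<Rightarrow> real" where "E f = expectation (\<lambda>x. (f x)\<^sup>2)" for f
  define m where "m = Inf (E ` C)"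
  obtain K where K: "K \<ge> 1" "\<And>x. x \<in> space M \<Longrightarrow> \<bar>F x\<bar> \<le> K"
    using bounded_measurable_bound[OF F(1)] by metis
  have C_bm: "f \<in> bounded_measurable M" if "f \<in> C" for f
    using that unfolding C_def
    by (auto intro!: bounded_measurable_intros bounded_measurable_T F)
  have C_bound: "\<bar>f x\<bar> \<le> K" if "f \<in> C" "x \<in> space M" for f x
  proof -
    obtain S c where S: "weights S c" "f = (\<lambda>x. \<Sum>h\<in>S. c h * F (T h x))"
      using \<open>f \<in> C\<close> unfolding C_def by blast
    have "\<bar>f x\<bar> \<le> (\<Sum>h\<in>S. \<bar>c h * F (T h x)\<bar>)" unfolding S(2) by (rule sum_abs)
    also have "\<dots> \<le> (\<Sum>h\<in>S. c h * K)"
      using S(1) K T_space[OF that(2)] unfolding weights_def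
      by (intro sum_mono) (auto simp: abs_mult intro!: mult_left_mono)
    also have "\<dots> = K" using S(1) by (simp add: weights_def flip: sum_distrib_right)
    finally show ?thesis .
  qed
  have C_mean: "expectation f = 0" if "f \<in> C" for f
  proof -
    obtain S c where S: "weights S c" "f = (\<lambda>x. \<Sum>h\<in>S. c h * F (T h x))"
      using \<open>f \<in> C\<close> unfolding C_def by blast
    show ?thesis unfolding S(2)
      using F integral_T[OF bounded_measurable_measurable[OF F(1)]]
      by (subst Bochner_Integration.integral_sum)
        (auto intro!: bounded_measurable_integrable bounded_measurable_intros bounded_measurable_T)
  qed
  have C_mid: "(\<lambda>x. (f x + g x) / 2) \<in> C" if "f \<in> C" "g \<in> C" for f g
  proof -
    obtain S c where S: "weights S c" "f = (\<lambda>x. \<Sum>h\<in>S. c h * F (T h x))"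
      using \<open>f \<in> C\<close> unfolding C_def by blast
    obtain S' c' where S': "weights S' c'" "g = (\<lambda>x. \<Sum>h\<in>S'. c' h * F (T h x))"
      using \<open>g \<in> C\<close> unfolding C_def by blast
    show ?thesis unfolding C_def S(2) S'(2) weights_midpoint(2)[OF S(1) S'(1), symmetric]
      using weights_midpoint(1)[OF S(1) S'(1)] by blast
  qed
  have "weights {0} (\<lambda>h. if h = (0 :: int ^ 'd) then 1 else 0)" by (auto simp: weights_def)
  then have C_ne: "C \<noteq> {}" unfolding C_def by blast
  have E_nonneg: "0 \<le> E f" for f by (simp add: E_def)
  then have m_le: "m \<le> E f" if "f \<in> C" for f
    unfolding m_def using that by (intro cInf_lower bdd_belowI[of _ 0]) auto
  have near: "E (\<lambda>x. f x - g x) \<le> 4 * \<delta>" if "f \<in> C" "g \<in> C" "E f \<le> m + \<delta>" "E g \<le> m + \<delta>" for f g \<delta>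
  proof -
    have "E (\<lambda>x. f x - g x) = expectation (\<lambda>x. 2 * (f x)\<^sup>2 + 2 * (g x)\<^sup>2 - 4 * ((f x + g x) / 2)\<^sup>2)"
      unfolding E_def by (intro Bochner_Integration.integral_cong refl) (simp add: power2_eq_square field_simps)
    also have "\<dots> = 2 * E f + 2 * E g - 4 * E (\<lambda>x. (f x + g x) / 2)"
      unfolding E_def using C_bm[OF that(1)] C_bm[OF that(2)] C_bm[OF C_mid[OF that(1,2)]]
      by (simp add: bounded_measurable_integrable bounded_measurable_power)
    finally show ?thesis using m_le[OF C_mid[OF that(1,2)]] that(3,4) by simp
  qed
  have "\<exists>f\<in>C. E f < m + (1 / 4) ^ n" for n :: nat
    using cInf_lessD[of "E ` C" "m + (1 / 4) ^ n"] C_ne by (auto simp: m_def)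
  then obtain f where f: "\<And>n. f n \<in> C" "\<And>n::nat. E (f n) < m + (1 / 4) ^ n" by metis
  note f_bm = C_bm[OF f(1)]
  note [measurable] = bounded_measurable_measurable[OF f_bm]
  have "E (\<lambda>x. f (Suc n) x - f n x) \<le> 4 * (1 / 4) ^ n" for n
  proof (rule near[OF f(1) f(1)])
    have "(1 / 4 :: real) ^ Suc n \<le> (1 / 4) ^ n" by (rule power_decreasing) auto
    then show "E (f (Suc n)) \<le> m + (1 / 4) ^ n" using f(2)[of "Suc n"] by linarith
  qed (use f(2)[of n] in simp)
  then have conv: "AE x in M. convergent (\<lambda>n. f n x)"
    unfolding E_def by (intro AE_convergent_if_fast_Cauchy[where B = 4] f_bm)
  define g where "g x = lim (\<lambda>n. f n x)" for x
  \<comment> \<open>The truncation makes the limit bounded also on the null set where the sequence diverges.\<close>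
  define G where "G x = max (- K) (min K (g x))" for x
  have [measurable]: "g \<in> borel_measurable M" unfolding g_def by measurable
  have G_bm: "G \<in> bounded_measurable M"
    unfolding G_def using K(1) by (intro bounded_measurableI[where K = K]) auto
  note [measurable] = bounded_measurable_measurable[OF G_bm]
  have lim: "AE x in M. (\<lambda>n. f n x) \<longlonglongrightarrow> G x"
    using conv AE_space
  proof eventually_elim
    case (elim x)
    then have l: "(\<lambda>n. f n x) \<longlonglongrightarrow> g x" by (simp add: g_def convergent_LIMSEQ_iff)
    have "\<bar>f n x\<bar> \<le> K" for n using C_bound[OF f(1) elim(2)] .
    then have "- K \<le> f n x" "f n x \<le> K" for n by (simp_all add: abs_le_iff minus_le_iff)
    then have "- K \<le> g x" "g x \<le> K" using LIMSEQ_le_const[OF l] LIMSEQ_le_const2[OF l] by blast+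
    then show ?case using l by (simp add: G_def)
  qed
  have fb: "AE x in M. norm (f n x) \<le> K" for n
    using C_bound[OF f(1)] by simp
  have "(\<lambda>n. expectation (f n)) \<longlonglongrightarrow> expectation G"
    using lim fb by (intro integral_dominated_convergence[where w = "\<lambda>_. K"]) auto
  then have G_mean: "expectation G = 0"
    by (simp add: C_mean[OF f(1)] LIMSEQ_const_iff)
  have "(\<lambda>n. E (f n)) \<longlonglongrightarrow> E G" unfolding E_def
  proof (intro integral_dominated_convergence[where w = "\<lambda>_. K\<^sup>2"])
    show "AE x in M. (\<lambda>n. (f n x)\<^sup>2) \<longlonglongrightarrow> (G x)\<^sup>2"
      using lim by eventually_elim (intro tendsto_power)
    show "AE x in M. norm ((f n x)\<^sup>2) \<le> K\<^sup>2" for n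
      using fb[of n]
    proof eventually_elim
      case (elim x)
      then have "\<bar>f n x\<bar>\<^sup>2 \<le> K\<^sup>2" by (intro power_mono) auto
      then show ?case by simp
    qed
  qed auto
  then have m_G: "m \<le> E G" "E G \<le> m"
  proof -
    assume l: "(\<lambda>n. E (f n)) \<longlonglongrightarrow> E G"
    show "m \<le> E G" by (rule LIMSEQ_le_const[OF l]) (use m_le[OF f(1)] in blast)
    have "(\<lambda>n. m + (1 / 4) ^ n) \<longlonglongrightarrow> m + 0"
      by (intro tendsto_intros LIMSEQ_realpow_zero) auto
    from LIMSEQ_le[OF l this] show "E G \<le> m" using f(2) by (auto intro: less_imp_le)
  qed
  have inv: "AE x in M. G (T v x) = G x" for v
  proof -
    have lim': "AE x in M. (\<lambda>n. f n (T v x)) \<longlonglongrightarrow> G (T v x)" by (rule AE_T[OF lim])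
    have "(\<lambda>n. E (\<lambda>x. f n (T v x) - f n x)) \<longlonglongrightarrow> E (\<lambda>x. G (T v x) - G x)" unfolding E_def
    proof (intro integral_dominated_convergence[where w = "\<lambda>_. (2 * K)\<^sup>2"])
      show "AE x in M. (\<lambda>n. (f n (T v x) - f n x)\<^sup>2) \<longlonglongrightarrow> (G (T v x) - G x)\<^sup>2"
        using lim lim' by eventually_elim (intro tendsto_intros)
      show "AE x in M. norm ((f n (T v x) - f n x)\<^sup>2) \<le> (2 * K)\<^sup>2" for n
        using fb[of n] AE_T[OF fb[of n], of v]
      proof eventually_elim
        case (elim x)
        then have "\<bar>f n (T v x) - f n x\<bar> \<le> 2 * K" by auto
        then have "\<bar>f n (T v x) - f n x\<bar>\<^sup>2 \<le> (2 * K)\<^sup>2" by (rule power_mono) auto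
        then show ?case by simp
      qed
    qed auto
    moreover have "E (\<lambda>x. f n (T v x) - f n x) \<le> 4 * (1 / 4) ^ n" for n
    proof -
      obtain S c where S: "weights S c" "f n = (\<lambda>x. \<Sum>h\<in>S. c h * F (T h x))"
        using f(1)[of n] by (auto simp: C_def)
      define f' where "f' x = (\<Sum>h\<in>(\<lambda>h. h + v) ` S. c (h - v) * F (T h x))" for x
      have eq: "f n (T v x) = f' x" if "x \<in> space M" for x
        unfolding S(2) f'_def using weights_translate(2)[OF S(1) that] .
      have "f' = (\<lambda>x. \<Sum>h\<in>(\<lambda>h. h + v) ` S. c (h - v) * F (T h x))"
        by (simp add: fun_eq_iff f'_def)
      then have "f' \<in> C" unfolding C_def using weights_translate(1)[OF S(1)] by blast
      moreover have "E f' = E (f n)"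
      proof -
        have "E f' = expectation (\<lambda>x. (f n (T v x))\<^sup>2)" unfolding E_def
          by (intro Bochner_Integration.integral_cong refl) (simp add: eq)
        then show ?thesis unfolding E_def using integral_T[of "\<lambda>x. (f n x)\<^sup>2"] by simp
      qed
      moreover have "E (\<lambda>x. f n (T v x) - f n x) = E (\<lambda>x. f' x - f n x)" unfolding E_def
        by (intro Bochner_Integration.integral_cong refl) (simp add: eq)
      ultimately show ?thesis using near[OF _ f(1), of f'] f(2)[of n] by (simp add: less_imp_le)
    qed
    moreover have "(\<lambda>n. 4 * (1 / 4) ^ n :: real) \<longlonglongrightarrow> 4 * 0"
      by (intro tendsto_intros LIMSEQ_realpow_zero) auto
    ultimately have "E (\<lambda>x. G (T v x) - G x) \<le> 4 * 0"
      using LIMSEQ_le by blast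
    then have "E (\<lambda>x. G (T v x) - G x) = 0" using E_nonneg by (simp add: antisym)
    then have "AE x in M. (G (T v x) - G x)\<^sup>2 = 0" unfolding E_def
      using bounded_measurable_diff[OF bounded_measurable_T[OF G_bm] G_bm]
      by (subst (asm) integral_nonneg_eq_0_iff_AE)
        (auto intro!: bounded_measurable_integrable bounded_measurable_power)
    then show ?thesis by eventually_elim simp
  qed
  have "AE x in M. G x = 0" by (rule ergodic_AE_invariant_zero[OF assms(1) G_bm G_mean inv])
  then have "E G = 0" unfolding E_def by (intro integral_eq_zero_AE) auto
  then have "m = 0" using m_G by simp
  then have "\<exists>f\<in>C. E f < \<epsilon>"
    using cInf_lessD[of "E ` C" \<epsilon>] C_ne \<open>\<epsilon> > 0\<close> by (auto simp: m_def)
  then show ?thesis using that unfolding C_def E_def by blast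
qed

end

section \<open>Averages over cubes\<close>

lemma card_vec_Collect:
  fixes A :: "int set"
  assumes "finite A"
  shows "finite {v :: int ^ 'd. \<forall>i. v $ i \<in> A}"
    and "card {v :: int ^ 'd. \<forall>i. v $ i \<in> A} = card A ^ CARD('d)"
proof -
  have bij: "bij_betw (\<lambda>f. \<chi> i. f i) (PiE (UNIV :: 'd set) (\<lambda>_. A)) {v :: int ^ 'd. \<forall>i. v $ i \<in> A}"
    by (rule bij_betwI[where g = "\<lambda>v i. v $ i"]) (auto simp: PiE_UNIV_domain vec_eq_iff)
  show "finite {v :: int ^ 'd. \<forall>i. v $ i \<in> A}"
    using bij_betw_finite[OF bij] assms by (simp add: finite_PiE)
  show "card {v :: int ^ 'd. \<forall>i. v $ i \<in> A} = card A ^ CARD('d)"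
    using bij_betw_same_card[OF bij] by (simp add: card_PiE)
qed

definition cube :: "nat \<Rightarrow> (int ^ 'd) set"
  where "cube N = {v. \<forall>i. v $ i \<in> {1..int N}}"

definition cube_average :: "nat \<Rightarrow> (int ^ 'd \<Rightarrow> real) \<Rightarrow> real"
  where "cube_average N a = (\<Sum>x\<in>cube N. a x) / real N ^ CARD('d)"

lemma finite_cube [simp]: "finite (cube N)"
  unfolding cube_def by (rule card_vec_Collect) simp

lemma card_cube: "card (cube N :: (int ^ 'd) set) = N ^ CARD('d)"
  unfolding cube_def by (subst card_vec_Collect) auto

lemma cube_average_mono: "(\<And>x. a x \<le> b x) \<Longrightarrow> cube_average N a \<le> cube_average N b"
  unfolding cube_average_def by (intro divide_right_mono sum_mono) auto

lemma cube_average_add: "cube_average N (\<lambda>x. a x + b x) = cube_average N a + cube_average N b"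
  unfolding cube_average_def by (simp add: sum.distrib add_divide_distrib)

lemma cube_average_cmult: "cube_average N (\<lambda>x. k * a x) = k * cube_average N a"
  unfolding cube_average_def by (simp add: sum_distrib_left)

lemma cube_average_sum: "cube_average N (\<lambda>x. \<Sum>i\<in>I. a i x) = (\<Sum>i\<in>I. cube_average N (a i))"
  unfolding cube_average_def by (simp add: sum_divide_distrib sum.swap[of _ I])

lemma cube_average_const: "N > 0 \<Longrightarrow> cube_average N (\<lambda>x :: int ^ 'd. k) = k"
  unfolding cube_average_def by (simp add: card_cube)

lemma cube_average_square_le:
  fixes a :: "int ^ 'd \<Rightarrow> real"
  assumes "N > 0"
  shows "(cube_average N a)\<^sup>2 \<le> cube_average N (\<lambda>x. (a x)\<^sup>2)"
proof -
  define m where "m = cube_average N a"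
  have "0 \<le> cube_average N (\<lambda>x. (a x - m)\<^sup>2)"
    unfolding cube_average_def by (intro divide_nonneg_nonneg sum_nonneg) auto
  also have "(\<lambda>x. (a x - m)\<^sup>2) = (\<lambda>x. (a x)\<^sup>2 + (- 2 * m * a x + m\<^sup>2))"
    by (simp add: fun_eq_iff power2_eq_square algebra_simps)
  also have "cube_average N \<dots> = cube_average N (\<lambda>x. (a x)\<^sup>2) - m\<^sup>2"
    by (simp only: cube_average_add cube_average_cmult cube_average_const[OF assms] flip: m_def)
      (simp add: power2_eq_square)
  finally show ?thesis by (simp add: m_def)
qed

text \<open>Cubes form a Foelner sequence: a cube and its translate by a fixed vector have a smaller
cube in common whose side length differs by a constant only.\<close>

lemma cube_average_shift:
  fixes a :: "int ^ 'd \<Rightarrow> real"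
  assumes "\<And>x. \<bar>a x\<bar> \<le> K"
  shows "(\<lambda>N. cube_average N a - cube_average N (\<lambda>x. a (x + h))) \<longlonglongrightarrow> 0"
proof -
  let ?d = "CARD('d)"
  define m where "m = Max (range (\<lambda>i. nat \<bar>h $ i\<bar>))"
  have m: "\<bar>h $ i\<bar> \<le> int m" for i
    using Max_ge[of "range (\<lambda>i. nat \<bar>h $ i\<bar>)" "nat \<bar>h $ i\<bar>"] by (simp add: m_def nat_le_iff)
  have "\<bar>cube_average N a - cube_average N (\<lambda>x. a (x + h))\<bar> \<le> 2 * K * (1 - (real (N - 2 * m) / real N) ^ ?d)"
    if "N > 0" for N
  proof -
    let ?B = "cube N :: (int ^ 'd) set" and ?B' = "(\<lambda>x. x + h) ` cube N :: (int ^ 'd) set"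
    let ?C = "{v :: int ^ 'd. \<forall>i. v $ i \<in> {1 + int m..int N - int m}}"
    have C: "?C \<subseteq> ?B \<inter> ?B'"
    proof
      fix v assume v: "v \<in> ?C"
      have "1 \<le> v $ i \<and> v $ i \<le> int N \<and> 1 \<le> v $ i - h $ i \<and> v $ i - h $ i \<le> int N" for i
      proof -
        have "1 + int m \<le> v $ i" "v $ i \<le> int N - int m" using v by auto
        then show ?thesis using m[of i] by (simp add: abs_le_iff)
      qed
      then have "v \<in> cube N" "v - h \<in> cube N" by (auto simp: cube_def)
      then show "v \<in> ?B \<inter> ?B'" by (auto simp: image_iff intro!: bexI[of _ "v - h"])
    qed
    have cardC: "card ?C = (N - 2 * m) ^ ?d"
    proof -
      have "nat (int N - 2 * int m) = N - 2 * m" by linarith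
      then show ?thesis by (subst card_vec_Collect) auto
    qed
    have inj: "inj_on (\<lambda>x. x + h) ?B" by (auto simp: inj_on_def)
    have "(\<Sum>x\<in>?B. a (x + h)) = sum a ?B'" by (simp add: sum.reindex[OF inj])
    moreover have "sum a ?B = sum a (?B - ?B') + sum a (?B \<inter> ?B')"
      using sum.Int_Diff[of ?B a ?B'] by simp
    moreover have "sum a ?B' = sum a (?B' - ?B) + sum a (?B \<inter> ?B')"
      using sum.Int_Diff[of ?B' a ?B] by (simp add: Int_commute)
    ultimately have "\<bar>sum a ?B - (\<Sum>x\<in>?B. a (x + h))\<bar> \<le> \<bar>sum a (?B - ?B')\<bar> + \<bar>sum a (?B' - ?B)\<bar>"
      by linarith
    also have "\<dots> \<le> K * real (card (?B - ?B')) + K * real (card (?B' - ?B))"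
    proof -
      have "\<bar>sum a X\<bar> \<le> K * real (card X)" for X
        using order_trans[OF sum_abs sum_bounded_above[of X "\<lambda>x. \<bar>a x\<bar>" K]] assms
        by (simp add: mult.commute)
      then show ?thesis by (intro add_mono)
    qed
    also have "\<dots> \<le> 2 * K * (real N ^ ?d - real (N - 2 * m) ^ ?d)"
    proof -
      have "(N - 2 * m) ^ ?d \<le> card (?B \<inter> ?B')"
        using card_mono[OF _ C] cardC by simp
      moreover have "card (?B - ?B') + card (?B \<inter> ?B') = N ^ ?d"
        using card_Int_Diff[of ?B ?B'] by (simp add: card_cube)
      moreover have "card (?B' - ?B) + card (?B \<inter> ?B') = N ^ ?d"
        using card_Int_Diff[of ?B' ?B] by (simp add: card_cube card_image[OF inj] Int_commute)
      ultimately have "real (card (?B - ?B')) \<le> real N ^ ?d - real (N - 2 * m) ^ ?d"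
        "real (card (?B' - ?B)) \<le> real N ^ ?d - real (N - 2 * m) ^ ?d"
        unfolding of_nat_power[symmetric] by linarith+
      moreover have "K \<ge> 0" using assms[of 0] by simp
      ultimately have "K * real (card (?B - ?B')) \<le> K * (real N ^ ?d - real (N - 2 * m) ^ ?d)"
        "K * real (card (?B' - ?B)) \<le> K * (real N ^ ?d - real (N - 2 * m) ^ ?d)"
        by (intro mult_left_mono; simp)+
      then show ?thesis by linarith
    qed
    finally have "\<bar>sum a ?B - (\<Sum>x\<in>?B. a (x + h))\<bar> / real N ^ ?d \<le> 2 * K * (real N ^ ?d - real (N - 2 * m) ^ ?d) / real N ^ ?d"
      by (intro divide_right_mono) auto
    then show ?thesis using that
      by (simp add: cube_average_def diff_divide_distrib[symmetric] power_divide right_diff_distrib)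
        (simp add: diff_divide_distrib)
  qed
  then have ev: "\<forall>\<^sub>F N in sequentially. norm (cube_average N a - cube_average N (\<lambda>x. a (x + h)))
      \<le> 2 * K * (1 - (real (N - 2 * m) / real N) ^ ?d)"
    by (auto intro: eventually_mono[OF eventually_gt_at_top[of 0]])
  have "(\<lambda>N. 1 - 2 * real m / real N) \<longlonglongrightarrow> 1 - 0"
    by (intro tendsto_intros lim_const_over_n)
  moreover have "\<forall>\<^sub>F N in sequentially. 1 - 2 * real m / real N = real (N - 2 * m) / real N"
    using eventually_ge_at_top[of "Suc (2 * m)"] by eventually_elim (simp add: of_nat_diff field_simps)
  ultimately have "(\<lambda>N. real (N - 2 * m) / real N) \<longlonglongrightarrow> 1"
    by (simp add: tendsto_cong)
  then have "(\<lambda>N. 2 * K * (1 - (real (N - 2 * m) / real N) ^ ?d)) \<longlonglongrightarrow> 2 * K * (1 - 1 ^ ?d)"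
    by (intro tendsto_intros)
  then have "(\<lambda>N. 2 * K * (1 - (real (N - 2 * m) / real N) ^ ?d)) \<longlonglongrightarrow> 0" by simp
  then show ?thesis by (rule Lim_null_comparison[OF ev])
qed

section \<open>The van der Corput argument\<close>

context lattice_action
begin

text \<open>The function \<open>q h k\<close> is the part of the product of two translates of \<open>f\<close> that stays in the class,
and \<open>e h k\<close> bounds the remaining error. Allowing \<open>q h k = 0\<close> admits pairs \<open>h, k\<close> (such as \<open>h = k\<close>) for
which the product is bounded but not small, provided that they carry little weight. The factor \<open>b\<close>
stands for a difference of two speeds.\<close>

definition decorrelating :: "('a \<Rightarrow> real) set \<Rightarrow> bool"
  where "decorrelating \<A> \<longleftrightarrow> (\<forall>f\<in>\<A>. f \<in> bounded_measurable M \<and> expectation f = 0 \<and>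
    (\<forall>b \<epsilon>. b \<noteq> 0 \<longrightarrow> \<epsilon> > 0 \<longrightarrow> (\<exists>S c q e. weights S c \<and>
      (\<forall>h\<in>S. \<forall>k\<in>S. (q h k \<in> \<A> \<or> q h k = (\<lambda>_. 0)) \<and>
        (\<forall>x\<in>space M. \<bar>f (T (b *s h) x) * f (T (b *s k) x) - q h k x\<bar> \<le> e h k)) \<and>
      (\<Sum>h\<in>S. \<Sum>k\<in>S. c h * c k * e h k) < \<epsilon>)))"

lemma T_scaled_add:
  "y \<in> space M \<Longrightarrow> T (b *s (x + h)) y = T (b *s h) (T (b *s x) y)"
  by (subst T_add[symmetric]) (auto simp: vec.scale_right_distrib add.commute)

text \<open>Induction on the number of functions. Invariance of the measure brings one factor \<open>f\<^sub>i\<^sub>0\<close>, \<open>i\<^sub>0 \<noteq> j\<close>, to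
rest. Averages over a cube hardly change if \<open>x\<close> is smeared out by fixed weights \<open>c\<close>, and after the Cauchy-Schwarz
inequality the factor at rest disappears. What remains are averages of products of pairs \<open>x + h\<close>, \<open>x + k\<close>
over one function less, with \<open>f\<^sub>i\<close> replaced by the product of its translates by \<open>b\<^sub>i h\<close> and \<open>b\<^sub>i k\<close>. For the
index \<open>j\<close> this product is, up to a small error, in the class again, so that the induction hypothesis
applies.\<close>

theorem van_der_Corput_average:
  fixes f :: "'i \<Rightarrow> 'a \<Rightarrow> real" and a :: "'i \<Rightarrow> int"
  assumes A: "decorrelating \<A>"
    and "finite I" "j \<in> I" "f j \<in> \<A>"
    and "\<And>i. i \<in> I \<Longrightarrow> f i \<in> bounded_measurable M"
    and "\<And>i. i \<in> I - {j} \<Longrightarrow> a i \<noteq> a j"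
  shows "(\<lambda>N. cube_average N (\<lambda>x. expectation (\<lambda>y. \<Prod>i\<in>I. f i (T (a i *s x) y)))) \<longlonglongrightarrow> 0"
  using assms(2-)
proof (induction "card I" arbitrary: I f a rule: less_induct)
  case less
  show ?case
  proof (cases "I = {j}")
    case True
    have "expectation (\<lambda>y. f j (T v y)) = 0" for v
      using integral_T[of "f j" v] A less.prems unfolding decorrelating_def
      by (auto simp: bounded_measurable_measurable)
    then show ?thesis by (simp add: True cube_average_def)
  next
    case False
    then obtain i0 where i0: "i0 \<in> I" "i0 \<noteq> j" using less.prems by blast
    define I' where "I' = I - {i0}"
    have I': "finite I'" "j \<in> I'" "card I' < card I" "I = insert i0 I'" "i0 \<notin> I'"
      using less.prems(1,2) i0 card_Diff1_less[of I i0] by (auto simp: I'_def)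
    \<comment> \<open>Speeds relative to the factor that is brought to rest.\<close>
    define b where "b i = a i - a i0" for i
    have b: "b j \<noteq> 0" "\<And>i. i \<in> I' - {j} \<Longrightarrow> b i \<noteq> b j"
      using less.prems(5)[of i0, THEN not_sym] i0 less.prems(5) by (simp_all add: b_def I'_def)
    have f_bm: "f i \<in> bounded_measurable M" if "i \<in> I" for i using less.prems(4) that .
    define G where "G x y = (\<Prod>i\<in>I'. f i (T (b i *s x) y))" for x y
    define \<alpha> where "\<alpha> x = expectation (\<lambda>y. f i0 y * G x y)" for x
    have G_bm: "G x \<in> bounded_measurable M" for x
      unfolding G_def using I' by (intro bounded_measurable_intros bounded_measurable_T f_bm) auto
    have \<alpha>: "expectation (\<lambda>y. \<Prod>i\<in>I. f i (T (a i *s x) y)) = \<alpha> x" for x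
    proof -
      have "\<alpha> x = expectation (\<lambda>y. f i0 (T (a i0 *s x) y) * G x (T (a i0 *s x) y))"
        unfolding \<alpha>_def using f_bm[OF i0(1)] G_bm
        by (intro integral_T[symmetric] bounded_measurable_measurable bounded_measurable_intros)
      also have "\<dots> = expectation (\<lambda>y. \<Prod>i\<in>I. f i (T (a i *s x) y))"
      proof (intro Bochner_Integration.integral_cong refl)
        fix y assume y: "y \<in> space M"
        have "T (b i *s x) (T (a i0 *s x) y) = T (a i *s x) y" for i
          using y by (subst T_add[symmetric]) (auto simp: b_def vector_sub_rdistrib)
        then show "f i0 (T (a i0 *s x) y) * G x (T (a i0 *s x) y) = (\<Prod>i\<in>I. f i (T (a i *s x) y))"
          unfolding G_def I'(4) using I' by simp
      qed
      finally show ?thesis ..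
    qed
    obtain K where K: "K \<ge> 1" "\<And>i y. i \<in> I \<Longrightarrow> y \<in> space M \<Longrightarrow> \<bar>f i y\<bar> \<le> K"
    proof -
      have "\<exists>k. \<forall>i\<in>I. k i \<ge> 1 \<and> (\<forall>y\<in>space M. \<bar>f i y\<bar> \<le> k i)"
        using bounded_measurable_bound[OF f_bm] by (intro bchoice) metis
      then obtain k where k: "\<And>i. i \<in> I \<Longrightarrow> k i \<ge> 1 \<and> (\<forall>y\<in>space M. \<bar>f i y\<bar> \<le> k i)" by blast
      have "k i \<le> sum k I" if "i \<in> I" for i
        using that less.prems(1) k by (intro member_le_sum) force+
      then show ?thesis using that[of "sum k I"] k i0 by force
    qed
    define L where "L = (K\<^sup>2) ^ card I'"
    have K2: "1 \<le> K\<^sup>2" using K(1) by simp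
    have L: "1 \<le> L" unfolding L_def using K2 by (rule one_le_power)
    have G_bound: "\<bar>G x y\<bar> \<le> K ^ card I'" if "y \<in> space M" for x y
    proof -
      have "\<bar>G x y\<bar> \<le> (\<Prod>i\<in>I'. K)"
        unfolding G_def abs_prod using K(2) T_space[OF that] I' by (intro prod_mono) auto
      then show ?thesis by simp
    qed
    have \<alpha>_bound: "\<bar>\<alpha> x\<bar> \<le> K * K ^ card I'" for x
      unfolding \<alpha>_def
    proof (rule expectation_abs_le)
      show "(\<lambda>y. f i0 y * G x y) \<in> bounded_measurable M"
        using f_bm[OF i0(1)] G_bm by (intro bounded_measurable_intros)
      show "\<bar>f i0 y * G x y\<bar> \<le> K * K ^ card I'" if "y \<in> space M" for y
        unfolding abs_mult using K(1) K(2)[OF i0(1) that] G_bound[OF that] by (intro mult_mono) auto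
    qed
    show ?thesis unfolding \<alpha>
    proof (rule LIMSEQ_I)
      fix \<epsilon> :: real assume "\<epsilon> > 0"
      \<comment> \<open>With this value the total error \<open>K\<^sup>2 * L * \<delta>\<close> is half of \<open>(\<epsilon> / 2)\<^sup>2\<close>.\<close>
      define \<delta> where "\<delta> = (\<epsilon> / 2)\<^sup>2 / (2 * K\<^sup>2 * L)"
      have \<delta>: "\<delta> > 0" unfolding \<delta>_def using \<open>\<epsilon> > 0\<close> K(1) L
        by (intro divide_pos_pos mult_pos_pos zero_less_power) auto
      have "\<exists>S c q e. weights S c \<and>
        (\<forall>h\<in>S. \<forall>k\<in>S. (q h k \<in> \<A> \<or> q h k = (\<lambda>_. 0)) \<and>
          (\<forall>x\<in>space M. \<bar>f j (T (b j *s h) x) * f j (T (b j *s k) x) - q h k x\<bar> \<le> e h k)) \<and>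
        (\<Sum>h\<in>S. \<Sum>k\<in>S. c h * c k * e h k) < \<delta>"
        using A less.prems(3) b(1) \<delta> unfolding decorrelating_def by blast
      then obtain S c q e where S: "weights S c"
        and q: "\<And>h k. h \<in> S \<Longrightarrow> k \<in> S \<Longrightarrow> q h k \<in> \<A> \<or> q h k = (\<lambda>_. 0)"
        and e: "\<And>h k x. h \<in> S \<Longrightarrow> k \<in> S \<Longrightarrow> x \<in> space M \<Longrightarrow>
            \<bar>f j (T (b j *s h) x) * f j (T (b j *s k) x) - q h k x\<bar> \<le> e h k"
        and sum_e: "(\<Sum>h\<in>S. \<Sum>k\<in>S. c h * c k * e h k) < \<delta>"
        by blast
      have fin: "finite S" and c: "\<And>h. c h \<ge> 0" "sum c S = 1" using S by (auto simp: weights_def)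
      have q_bm: "q h k \<in> bounded_measurable M" if "h \<in> S" "k \<in> S" for h k
        using q[OF that] A unfolding decorrelating_def by auto
      define f' where "f' h k i = (if i = j then q h k else (\<lambda>y. f i (T (b i *s h) y) * f i (T (b i *s k) y)))" for h k i
      define \<gamma> where "\<gamma> h k x = expectation (\<lambda>y. \<Prod>i\<in>I'. f' h k i (T (b i *s x) y))" for h k x
      have f'_bm: "f' h k i \<in> bounded_measurable M" if "h \<in> S" "k \<in> S" "i \<in> I'" for h k i
        unfolding f'_def using that q_bm I' by (auto intro!: bounded_measurable_intros bounded_measurable_T f_bm)
      have \<gamma>_lim: "(\<lambda>N. cube_average N (\<gamma> h k)) \<longlonglongrightarrow> 0" if hk: "h \<in> S" "k \<in> S" for h k
      proof (cases "q h k \<in> \<A>")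
        case True
        then show ?thesis unfolding \<gamma>_def using I' b f'_bm hk
          by (intro less.hyps) (auto simp: f'_def[of _ _ j])
      next
        case False
        then have "f' h k j = (\<lambda>_. 0)" using q[OF hk] by (simp add: f'_def)
        then have "(\<Prod>i\<in>I'. f' h k i (T (b i *s x) y)) = 0" for x y
          using I' by (intro prod_zero) (auto intro!: bexI[of _ j])
        then show ?thesis by (simp add: \<gamma>_def cube_average_def)
      qed
      have GG: "expectation (\<lambda>y. G (x + h) y * G (x + k) y) \<le> \<gamma> h k x + L * e h k"
        if hk: "h \<in> S" "k \<in> S" for h k x
      proof -
        have le: "G (x + h) y * G (x + k) y \<le> (\<Prod>i\<in>I'. f' h k i (T (b i *s x) y)) + L * e h k"
          if y: "y \<in> space M" for y
        proof -
          define p where "p i = f i (T (b i *s h) (T (b i *s x) y)) * f i (T (b i *s k) (T (b i *s x) y))" for i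
          have eq: "G (x + h) y * G (x + k) y = (\<Prod>i\<in>I'. p i)"
            unfolding G_def p_def by (simp only: T_scaled_add[OF y] prod.distrib)
          also have "\<dots> = p j * (\<Prod>i\<in>I'-{j}. p i)" using I' by (simp add: prod.remove)
          finally have 1: "G (x + h) y * G (x + k) y = p j * (\<Prod>i\<in>I'-{j}. p i)" .
          have 2: "(\<Prod>i\<in>I'. f' h k i (T (b i *s x) y)) = q h k (T (b j *s x) y) * (\<Prod>i\<in>I'-{j}. p i)"
            using I' by (simp add: prod.remove f'_def p_def)
          have e0: "\<bar>p j - q h k (T (b j *s x) y)\<bar> \<le> e h k"
            unfolding p_def using e[OF hk T_space[OF y]] .
          have "\<bar>\<Prod>i\<in>I'-{j}. p i\<bar> \<le> (\<Prod>i\<in>I'-{j}. K\<^sup>2)"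
            unfolding abs_prod p_def abs_mult power2_eq_square using K I' T_space y
            by (intro prod_mono conjI mult_mono) auto
          also have "\<dots> = (K\<^sup>2) ^ card (I' - {j})" by simp
          also have "\<dots> \<le> L" unfolding L_def using K2 I' by (intro power_increasing card_mono) auto
          finally have "\<bar>(p j - q h k (T (b j *s x) y)) * (\<Prod>i\<in>I'-{j}. p i)\<bar> \<le> e h k * L"
            unfolding abs_mult using e0 by (intro mult_mono) auto
          then show ?thesis unfolding 1 2 by (simp add: algebra_simps abs_le_iff)
        qed
        have "expectation (\<lambda>y. G (x + h) y * G (x + k) y)
            \<le> expectation (\<lambda>y. (\<Prod>i\<in>I'. f' h k i (T (b i *s x) y)) + L * e h k)"
          using le f'_bm[OF hk] G_bm
          by (intro integral_mono bounded_measurable_integrable bounded_measurable_intros bounded_measurable_T) auto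
        also have "\<dots> = \<gamma> h k x + L * e h k"
          unfolding \<gamma>_def using f'_bm[OF hk]
          by (subst Bochner_Integration.integral_add)
            (auto simp: prob_space intro!: bounded_measurable_integrable bounded_measurable_intros bounded_measurable_T)
        finally show ?thesis .
      qed
      define \<beta> where "\<beta> x = (\<Sum>h\<in>S. c h * \<alpha> (x + h))" for x
      have \<beta>_sq: "(\<beta> x)\<^sup>2 \<le> K\<^sup>2 * ((\<Sum>h\<in>S. \<Sum>k\<in>S. c h * c k * \<gamma> h k x) + L * \<delta>)" for x
      proof -
        define H where "H y = (\<Sum>h\<in>S. c h * G (x + h) y)" for y
        have H_bm: "H \<in> bounded_measurable M"
          unfolding H_def using G_bm by (intro bounded_measurable_intros)
        have "\<beta> x = expectation (\<lambda>y. f i0 y * H y)"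
          unfolding \<beta>_def \<alpha>_def H_def sum_distrib_left using f_bm[OF i0(1)] G_bm
          by (subst Bochner_Integration.integral_sum)
            (auto intro!: bounded_measurable_integrable bounded_measurable_intros simp: mult.left_commute)
        then have "(\<beta> x)\<^sup>2 \<le> expectation (\<lambda>y. (f i0 y * H y)\<^sup>2)"
          using f_bm[OF i0(1)] H_bm by (auto intro!: expectation_square_le bounded_measurable_intros)
        also have "\<dots> \<le> expectation (\<lambda>y. K\<^sup>2 * (H y)\<^sup>2)"
        proof (intro integral_mono bounded_measurable_integrable bounded_measurable_intros f_bm[OF i0(1)] H_bm)
          fix y assume "y \<in> space M"
          then have "(f i0 y)\<^sup>2 \<le> K\<^sup>2" using power_mono[OF K(2)[OF i0(1)], of y 2] by simp
          then show "(f i0 y * H y)\<^sup>2 \<le> K\<^sup>2 * (H y)\<^sup>2" by (simp add: power_mult_distrib mult_right_mono)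
        qed
        also have "\<dots> = K\<^sup>2 * expectation (\<lambda>y. (H y)\<^sup>2)" by simp
        also have "(\<lambda>y. (H y)\<^sup>2) = (\<lambda>y. \<Sum>h\<in>S. \<Sum>k\<in>S. c h * c k * (G (x + h) y * G (x + k) y))"
          unfolding H_def power2_eq_square sum_product by (simp add: mult_ac)
        also have "expectation \<dots> = (\<Sum>h\<in>S. \<Sum>k\<in>S. c h * c k * expectation (\<lambda>y. G (x + h) y * G (x + k) y))"
          using G_bm
          by (simp add: Bochner_Integration.integral_sum bounded_measurable_integrable bounded_measurable_intros)
        also have "\<dots> \<le> (\<Sum>h\<in>S. \<Sum>k\<in>S. c h * c k * (\<gamma> h k x + L * e h k))"
          using GG c(1) by (intro sum_mono mult_left_mono) auto
        also have "\<dots> = (\<Sum>h\<in>S. \<Sum>k\<in>S. c h * c k * \<gamma> h k x) + L * (\<Sum>h\<in>S. \<Sum>k\<in>S. c h * c k * e h k)"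
          by (simp add: sum_distrib_left sum.distrib algebra_simps)
        also have "\<dots> \<le> (\<Sum>h\<in>S. \<Sum>k\<in>S. c h * c k * \<gamma> h k x) + L * \<delta>"
          using sum_e L by (intro add_left_mono mult_left_mono) auto
        finally show ?thesis by (simp add: mult_left_mono)
      qed
      have "(\<lambda>N. K\<^sup>2 * ((\<Sum>h\<in>S. \<Sum>k\<in>S. c h * c k * cube_average N (\<gamma> h k)) + L * \<delta>))
          \<longlonglongrightarrow> K\<^sup>2 * ((\<Sum>h\<in>S. \<Sum>k\<in>S. c h * c k * 0) + L * \<delta>)"
        by (intro tendsto_intros \<gamma>_lim)
      moreover have "K\<^sup>2 * ((\<Sum>h\<in>S. \<Sum>k\<in>S. c h * c k * 0) + L * \<delta>) < (\<epsilon> / 2)\<^sup>2"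
        using \<open>\<epsilon> > 0\<close> K2 L K(1) by (simp add: \<delta>_def)
      ultimately have "\<forall>\<^sub>F N in sequentially. K\<^sup>2 * ((\<Sum>h\<in>S. \<Sum>k\<in>S. c h * c k * cube_average N (\<gamma> h k)) + L * \<delta>) < (\<epsilon> / 2)\<^sup>2"
        by (rule order_tendstoD(2))
      moreover have "\<forall>\<^sub>F N in sequentially. (0::nat) < N" by (rule eventually_gt_at_top)
      ultimately have ev1: "\<forall>\<^sub>F N in sequentially. \<bar>cube_average N \<beta>\<bar> < \<epsilon> / 2"
      proof eventually_elim
        case (elim N)
        have "(cube_average N \<beta>)\<^sup>2 \<le> cube_average N (\<lambda>x. (\<beta> x)\<^sup>2)"
          using elim(2) by (rule cube_average_square_le)
        also have "\<dots> \<le> cube_average N (\<lambda>x. K\<^sup>2 * ((\<Sum>h\<in>S. \<Sum>k\<in>S. c h * c k * \<gamma> h k x) + L * \<delta>))"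
          by (rule cube_average_mono[OF \<beta>_sq])
        also have "\<dots> = K\<^sup>2 * ((\<Sum>h\<in>S. \<Sum>k\<in>S. c h * c k * cube_average N (\<gamma> h k)) + L * \<delta>)"
          by (simp only: cube_average_cmult cube_average_add cube_average_sum cube_average_const[OF elim(2)])
        finally have "\<bar>cube_average N \<beta>\<bar>\<^sup>2 < (\<epsilon> / 2)\<^sup>2" using elim(1) by simp
        then show ?case using \<open>\<epsilon> > 0\<close> by (intro power2_less_imp_less[of _ "\<epsilon> / 2"]) auto
      qed
      have "(\<lambda>N. \<Sum>h\<in>S. c h * (cube_average N \<alpha> - cube_average N (\<lambda>x. \<alpha> (x + h)))) \<longlonglongrightarrow> (\<Sum>h\<in>S. c h * 0)"
        by (intro tendsto_intros cube_average_shift[OF \<alpha>_bound])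
      moreover have "(\<Sum>h\<in>S. c h * (cube_average N \<alpha> - cube_average N (\<lambda>x. \<alpha> (x + h)))) = cube_average N \<alpha> - cube_average N \<beta>" for N
        unfolding \<beta>_def cube_average_sum cube_average_cmult using c(2)
        by (simp add: right_diff_distrib sum_subtractf flip: sum_distrib_right)
      ultimately have "(\<lambda>N. cube_average N \<alpha> - cube_average N \<beta>) \<longlonglongrightarrow> 0" by simp
      then have "\<forall>\<^sub>F N in sequentially. dist (cube_average N \<alpha> - cube_average N \<beta>) 0 < \<epsilon> / 2"
        using \<open>\<epsilon> > 0\<close> by (intro tendstoD) auto
      then have "\<forall>\<^sub>F N in sequentially. norm (cube_average N \<alpha> - 0) < \<epsilon>"
        using ev1
      proof eventually_elim
        case (elim N)
        have "\<bar>cube_average N \<alpha>\<bar> \<le> \<bar>cube_average N \<alpha> - cube_average N \<beta>\<bar> + \<bar>cube_average N \<beta>\<bar>" by arith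
        then show ?case using elim by (simp add: dist_real_def)
      qed
      then show "\<exists>no. \<forall>N\<ge>no. norm (cube_average N \<alpha> - 0) < \<epsilon>"
        by (simp add: eventually_sequentially)
    qed
  qed
qed

end

section \<open>Weak mixing\<close>

context lattice_action
begin

definition weakly_mixing :: bool
  where "weakly_mixing \<longleftrightarrow> lattice_action.ergodic (M \<Otimes>\<^sub>M M) (\<lambda>v. map_prod (T v) (T v))"

lemma lattice_action_diagonal: "lattice_action (M \<Otimes>\<^sub>M M) (\<lambda>v. map_prod (T v) (T v))"
proof -
  interpret P: pair_prob_space M M ..
  show ?thesis
  proof
    fix v
    have eq: "map_prod (T v) (T v) = (\<lambda>(x, y). (T v x, T v y))" by auto
    show "map_prod (T v) (T v) \<in> M \<Otimes>\<^sub>M M \<rightarrow>\<^sub>M M \<Otimes>\<^sub>M M" unfolding eq by measurable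
    have "sigma_finite_measure (distr M M (T v))" unfolding T_preserves ..
    then have "distr M M (T v) \<Otimes>\<^sub>M distr M M (T v) = distr (M \<Otimes>\<^sub>M M) (M \<Otimes>\<^sub>M M) (\<lambda>(x, y). (T v x, T v y))"
      by (intro pair_measure_distr) auto
    then show "distr (M \<Otimes>\<^sub>M M) (M \<Otimes>\<^sub>M M) (map_prod (T v) (T v)) = M \<Otimes>\<^sub>M M"
      unfolding eq by (simp add: T_preserves)
  qed (auto simp: space_pair_measure T_zero T_add)
qed

text \<open>The squared correlations of \<open>f\<close> are the correlations of \<open>f(x) f(y)\<close> on the product space, where the
diagonal action is ergodic; the weighted double sum is therefore the squared norm of a convex
combination of translates, as in the mean ergodic theorem.\<close>

lemma weakly_mixing_correlations:
  assumes "weakly_mixing" and f: "f \<in> bounded_measurable M" "expectation f = 0" and "\<epsilon> > 0"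
  obtains S c where "weights S c"
    "(\<Sum>h\<in>S. \<Sum>k\<in>S. c h * c k * (expectation (\<lambda>x. f (T h x) * f (T k x)))\<^sup>2) < \<epsilon>"
proof -
  interpret P: lattice_action "M \<Otimes>\<^sub>M M" "\<lambda>v. map_prod (T v) (T v)" by (rule lattice_action_diagonal)
  interpret PP: pair_prob_space M M ..
  have tensor_bm: "(\<lambda>z. g (fst z) * g (snd z)) \<in> bounded_measurable (M \<Otimes>\<^sub>M M)"
    if "g \<in> bounded_measurable M" for g :: "'a \<Rightarrow> real"
    by (intro bounded_measurable_mult bounded_measurable_comp[OF that]) measurable
  have tensor_mean: "P.expectation (\<lambda>z. g (fst z) * g (snd z)) = (expectation g)\<^sup>2"
    if g: "g \<in> bounded_measurable M" for g :: "'a \<Rightarrow> real"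
  proof -
    have "(\<integral>x. (\<integral>y. g x * g y \<partial>M) \<partial>M) = P.expectation (\<lambda>(x, y). g x * g y)"
      using P.bounded_measurable_integrable[OF tensor_bm[OF g]]
      by (intro PP.integral_fst) (simp add: case_prod_beta')
    then show ?thesis by (simp add: case_prod_beta' power2_eq_square)
  qed
  define F where "F z = f (fst z) * f (snd z)" for z
  have F_bm: "F \<in> bounded_measurable (M \<Otimes>\<^sub>M M)" unfolding F_def by (rule tensor_bm[OF f(1)])
  have "P.expectation F = 0" unfolding F_def by (simp add: tensor_mean f)
  then obtain S c where S: "weights S c"
    and lt: "P.expectation (\<lambda>z. (\<Sum>h\<in>S. c h * F (map_prod (T h) (T h) z))\<^sup>2) < \<epsilon>"
    using P.ergodic_mean_small[OF _ F_bm _ \<open>\<epsilon> > 0\<close>] assms(1) unfolding weakly_mixing_def by blast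
  define p where "p h k x = f (T h x) * f (T k x)" for h k x
  have p_bm: "p h k \<in> bounded_measurable M" for h k
    unfolding p_def by (intro bounded_measurable_intros bounded_measurable_T f)
  have "P.expectation (\<lambda>z. (\<Sum>h\<in>S. c h * F (map_prod (T h) (T h) z))\<^sup>2)
      = P.expectation (\<lambda>z. \<Sum>h\<in>S. \<Sum>k\<in>S. c h * c k * (p h k (fst z) * p h k (snd z)))"
    unfolding F_def p_def power2_eq_square sum_product by (simp add: mult_ac)
  also have "\<dots> = (\<Sum>h\<in>S. \<Sum>k\<in>S. c h * c k * (expectation (p h k))\<^sup>2)"
    by (simp add: Bochner_Integration.integral_sum P.bounded_measurable_integrable
        bounded_measurable_intros tensor_bm p_bm tensor_mean del: integral_mult_right_zero)
  finally show ?thesis using that S lt unfolding p_def by simp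
qed

text \<open>Weak mixing passes to the sublattice \<open>b\<int>\<^sup>d\<close>: one of its finitely many cosets carries a definite
proportion \<open>1/Q\<close> of the weights. As all summands are nonnegative, restricting to this coset and
normalising costs a factor of at most \<open>Q\<^sup>2\<close>.\<close>

lemma weakly_mixing_correlations_multiples:
  assumes "weakly_mixing" and f: "f \<in> bounded_measurable M" "expectation f = 0" and "\<epsilon> > 0" "b \<noteq> 0"
  obtains S c where "weights S c"
    "(\<Sum>h\<in>S. \<Sum>k\<in>S. c h * c k * (expectation (\<lambda>x. f (T (b *s h) x) * f (T (b *s k) x)))\<^sup>2) < \<epsilon>"
proof -
  define R where "R = {v :: int ^ 'd. \<forall>i. v $ i \<in> {0..<\<bar>b\<bar>}}"
  define Q where "Q = card R"
  have fin: "finite R" unfolding R_def by (rule card_vec_Collect) simp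
  have "Q > 0"
  proof -
    have "0 \<in> R" using \<open>b \<noteq> 0\<close> by (simp add: R_def)
    then show ?thesis using fin by (auto simp: Q_def card_gt_0_iff)
  qed
  then have "\<epsilon> / (real Q)\<^sup>2 > 0" using \<open>\<epsilon> > 0\<close> by simp
  define \<rho> where "\<rho> h k = (expectation (\<lambda>x. f (T h x) * f (T k x)))\<^sup>2" for h k
  obtain S c where S: "weights S c" and lt: "(\<Sum>h\<in>S. \<Sum>k\<in>S. c h * c k * \<rho> h k) < \<epsilon> / (real Q)\<^sup>2"
    using weakly_mixing_correlations[OF assms(1) f \<open>\<epsilon> / (real Q)\<^sup>2 > 0\<close>] unfolding \<rho>_def by blast
  have finS: "finite S" and c: "\<And>h. c h \<ge> 0" "\<And>h. h \<notin> S \<Longrightarrow> c h = 0" "sum c S = 1"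
    using S by (auto simp: weights_def)
  define \<kappa> where "\<kappa> h = (\<chi> i. h $ i mod \<bar>b\<bar>)" for h :: "int ^ 'd"
  have \<kappa>R: "\<kappa> ` S \<subseteq> R" using \<open>b \<noteq> 0\<close> by (auto simp: \<kappa>_def R_def)
  define w where "w r = (\<Sum>h | h \<in> S \<and> \<kappa> h = r. c h)" for r
  have "(\<Sum>r\<in>R. w r) = 1"
    unfolding w_def using sum.group[OF finS fin \<kappa>R, of c] c(3) by simp
  have "\<exists>r\<in>R. w r \<ge> 1 / real Q"
  proof (rule ccontr)
    assume "\<not> ?thesis"
    then have "(\<Sum>r\<in>R. w r) < (\<Sum>r\<in>R. 1 / real Q)"
      using fin \<open>Q > 0\<close> by (intro sum_strict_mono) (auto simp: Q_def card_gt_0_iff)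
    also have "\<dots> = 1" using \<open>Q > 0\<close> by (simp add: Q_def)
    finally show False using \<open>(\<Sum>r\<in>R. w r) = 1\<close> by simp
  qed
  then obtain r where r: "r \<in> R" "w r \<ge> 1 / real Q" by blast
  then have w_pos: "w r > 0" using \<open>Q > 0\<close> by (auto intro: less_le_trans[of _ "1 / real Q"])
  define Sr where "Sr = {h. h \<in> S \<and> \<kappa> h = r}"
  define S' where "S' = {x. r + b *s x \<in> Sr}"
  define c' where "c' x = (if x \<in> S' then c (r + b *s x) / w r else 0)" for x
  have inj: "inj (\<lambda>x. r + b *s x)" using \<open>b \<noteq> 0\<close> by (auto simp: inj_def vec_eq_iff)
  have onto: "(\<lambda>x. r + b *s x) ` S' = Sr"
  proof -
    have "h \<in> (\<lambda>x. r + b *s x) ` S'" if h: "h \<in> Sr" for h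
    proof -
      define x where "x = (\<chi> i. (h $ i - r $ i) div b)"
      have "b dvd h $ i - r $ i" for i
      proof -
        have "r $ i = h $ i mod \<bar>b\<bar>" using h by (auto simp: Sr_def \<kappa>_def)
        then have "\<bar>b\<bar> dvd h $ i - r $ i" by (simp add: minus_mod_eq_mult_div)
        then show ?thesis by simp
      qed
      then have "h = r + b *s x" by (simp add: vec_eq_iff x_def)
      then show ?thesis using h by (auto simp: S'_def)
    qed
    then show ?thesis by (auto simp: S'_def)
  qed
  have sum': "(\<Sum>x\<in>S'. g (r + b *s x)) = sum g Sr" for g :: "int ^ 'd \<Rightarrow> real"
    unfolding onto[symmetric] by (subst sum.reindex) (auto intro: inj_on_subset[OF inj])
  have finS': "finite S'"
    using finite_imageD[of "\<lambda>x. r + b *s x" S'] inj_on_subset[OF inj] finS unfolding onto Sr_def by auto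
  have "sum c' S' = (\<Sum>x\<in>S'. c (r + b *s x) / w r)" by (simp add: c'_def)
  also have "\<dots> = 1" using sum'[of "\<lambda>h. c h / w r"] w_pos
    by (simp add: Sr_def w_def sum_divide_distrib[symmetric])
  finally have W: "weights S' c'" using finS' c w_pos by (auto simp: weights_def c'_def)
  have \<rho>_shift: "(expectation (\<lambda>x. f (T (b *s h) x) * f (T (b *s k) x)))\<^sup>2 = \<rho> (r + b *s h) (r + b *s k)" for h k
  proof -
    define p where "p = (\<lambda>x. f (T (b *s h) x) * f (T (b *s k) x))"
    have "p \<in> bounded_measurable M"
      unfolding p_def by (intro bounded_measurable_intros bounded_measurable_T f)
    then have "expectation p = expectation (\<lambda>x. p (T r x))"
      by (intro integral_T[symmetric] bounded_measurable_measurable)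
    also have "\<dots> = expectation (\<lambda>x. f (T (r + b *s h) x) * f (T (r + b *s k) x))"
      unfolding p_def by (intro Bochner_Integration.integral_cong refl) (simp add: T_add[symmetric] add.commute)
    finally show ?thesis by (simp add: \<rho>_def p_def)
  qed
  have "(\<Sum>h\<in>S'. \<Sum>k\<in>S'. c' h * c' k * (expectation (\<lambda>x. f (T (b *s h) x) * f (T (b *s k) x)))\<^sup>2)
      = (\<Sum>h\<in>S'. \<Sum>k\<in>S'. (c (r + b *s h) / w r) * (c (r + b *s k) / w r) * \<rho> (r + b *s h) (r + b *s k))"
    unfolding \<rho>_shift by (intro sum.cong refl) (simp add: c'_def)
  also have "\<dots> = (\<Sum>h\<in>Sr. \<Sum>k\<in>Sr. (c h / w r) * (c k / w r) * \<rho> h k)"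
    using sum'[of "\<lambda>h. \<Sum>k\<in>S'. (c h / w r) * (c (r + b *s k) / w r) * \<rho> h (r + b *s k)"]
      sum'[of "\<lambda>k. (c h / w r) * (c k / w r) * \<rho> h k" for h] by simp
  also have "\<dots> = (\<Sum>h\<in>Sr. \<Sum>k\<in>Sr. c h * c k * \<rho> h k) / (w r)\<^sup>2"
    by (simp add: sum_divide_distrib power2_eq_square field_simps)
  also have "\<dots> \<le> (\<Sum>h\<in>S. \<Sum>k\<in>S. c h * c k * \<rho> h k) / (w r)\<^sup>2"
  proof (intro divide_right_mono)
    have "(\<Sum>h\<in>Sr. \<Sum>k\<in>Sr. c h * c k * \<rho> h k) \<le> (\<Sum>h\<in>Sr. \<Sum>k\<in>S. c h * c k * \<rho> h k)"
      using finS c by (intro sum_mono sum_mono2) (auto simp: Sr_def \<rho>_def)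
    also have "\<dots> \<le> (\<Sum>h\<in>S. \<Sum>k\<in>S. c h * c k * \<rho> h k)"
      using finS c by (intro sum_mono2 sum_nonneg) (auto simp: Sr_def \<rho>_def)
    finally show "(\<Sum>h\<in>Sr. \<Sum>k\<in>Sr. c h * c k * \<rho> h k) \<le> (\<Sum>h\<in>S. \<Sum>k\<in>S. c h * c k * \<rho> h k)" .
  qed simp
  also have "\<dots> < (\<epsilon> / (real Q)\<^sup>2) / (w r)\<^sup>2"
    using lt w_pos by (intro divide_strict_right_mono) auto
  also have "\<dots> \<le> \<epsilon>"
  proof -
    have "1 \<le> real Q * w r" using r(2) \<open>Q > 0\<close> by (simp add: field_simps)
    then have "1 \<le> (real Q * w r)\<^sup>2" by (rule one_le_power)
    then show ?thesis using \<open>\<epsilon> > 0\<close> w_pos \<open>Q > 0\<close>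
      by (simp add: field_simps power_mult_distrib)
  qed
  finally show ?thesis using that W by blast
qed

lemma weights_Jensen:
  assumes "weights S c"
  shows "(\<Sum>h\<in>S. \<Sum>k\<in>S. c h * c k * r h k)\<^sup>2 \<le> (\<Sum>h\<in>S. \<Sum>k\<in>S. c h * c k * (r h k)\<^sup>2)"
proof -
  have c: "\<And>h. c h \<ge> 0" "sum c S = 1" using assms by (auto simp: weights_def)
  define m where "m = (\<Sum>h\<in>S. \<Sum>k\<in>S. c h * c k * r h k)"
  have one: "(\<Sum>h\<in>S. \<Sum>k\<in>S. c h * c k) = 1" using c(2) by (simp flip: sum_product)
  have "0 \<le> (\<Sum>h\<in>S. \<Sum>k\<in>S. c h * c k * (r h k - m)\<^sup>2)" using c by (intro sum_nonneg) auto
  also have "\<dots> = (\<Sum>h\<in>S. \<Sum>k\<in>S. c h * c k * (r h k)\<^sup>2 - 2 * m * (c h * c k * r h k) + m\<^sup>2 * (c h * c k))"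
    by (simp add: power2_eq_square algebra_simps)
  also have "\<dots> = (\<Sum>h\<in>S. \<Sum>k\<in>S. c h * c k * (r h k)\<^sup>2) - 2 * m * m + m\<^sup>2 * 1"
    unfolding one[symmetric] by (simp add: sum.distrib sum_subtractf sum_distrib_left m_def)
  finally show ?thesis unfolding m_def[symmetric] by (simp add: power2_eq_square)
qed

text \<open>A product of two translates of \<open>f\<close> differs from a function of mean zero by the correlation of \<open>f\<close> with a
translate of itself, and this constant is small for most pairs.\<close>

lemma weakly_mixing_decorrelating:
  assumes "weakly_mixing"
  shows "decorrelating {f \<in> bounded_measurable M. expectation f = 0}"
  unfolding decorrelating_def
proof (intro ballI conjI allI impI)
  fix f and b :: int and \<epsilon> :: real
  assume "f \<in> {f \<in> bounded_measurable M. expectation f = 0}" "b \<noteq> 0" "\<epsilon> > 0"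
  then have f: "f \<in> bounded_measurable M" "expectation f = 0" by auto
  define r where "r h k = expectation (\<lambda>x. f (T (b *s h) x) * f (T (b *s k) x))" for h k
  obtain S c where S: "weights S c" "(\<Sum>h\<in>S. \<Sum>k\<in>S. c h * c k * (r h k)\<^sup>2) < \<epsilon>\<^sup>2"
    using weakly_mixing_correlations_multiples[OF assms f _ \<open>b \<noteq> 0\<close>, of "\<epsilon>\<^sup>2"] \<open>\<epsilon> > 0\<close>
    unfolding r_def by auto
  define q where "q h k x = f (T (b *s h) x) * f (T (b *s k) x) - r h k" for h k x
  have "q h k \<in> bounded_measurable M" "expectation (q h k) = 0" for h k
  proof -
    have p: "(\<lambda>x. f (T (b *s h) x) * f (T (b *s k) x)) \<in> bounded_measurable M"
      by (intro bounded_measurable_intros bounded_measurable_T f)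
    then show "q h k \<in> bounded_measurable M"
      unfolding q_def by (intro bounded_measurable_diff bounded_measurable_const)
    show "expectation (q h k) = 0"
      unfolding q_def using bounded_measurable_integrable[OF p] by (simp add: prob_space r_def)
  qed
  moreover have "(\<Sum>h\<in>S. \<Sum>k\<in>S. c h * c k * \<bar>r h k\<bar>) < \<epsilon>"
  proof -
    have "(\<Sum>h\<in>S. \<Sum>k\<in>S. c h * c k * \<bar>r h k\<bar>)\<^sup>2 < \<epsilon>\<^sup>2"
      using weights_Jensen[OF S(1), of "\<lambda>h k. \<bar>r h k\<bar>"] S(2) by simp
    then show ?thesis using \<open>\<epsilon> > 0\<close> by (intro power2_less_imp_less[of _ \<epsilon>]) auto
  qed
  ultimately show "\<exists>S c q e. weights S c \<and>
    (\<forall>h\<in>S. \<forall>k\<in>S. (q h k \<in> {f \<in> bounded_measurable M. expectation f = 0} \<or> q h k = (\<lambda>_. 0)) \<and>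
      (\<forall>x\<in>space M. \<bar>f (T (b *s h) x) * f (T (b *s k) x) - q h k x\<bar> \<le> e h k)) \<and>
    (\<Sum>h\<in>S. \<Sum>k\<in>S. c h * c k * e h k) < \<epsilon>"
    using S(1) by (intro exI[of _ S] exI[of _ c] exI[of _ q] exI[of _ "\<lambda>h k. \<bar>r h k\<bar>"]) (auto simp: q_def)
qed auto

end

section \<open>Orbits of the special linear group on the lattice\<close>

definition shear :: "'d \<Rightarrow> int ^ 'd \<Rightarrow> int ^ 'd ^ 'd"
  where "shear k \<phi> = (\<chi> i. if i = k then axis k 1 + \<phi> else axis i 1)"

lemma sum_axis_mult: "(\<Sum>j\<in>UNIV. axis i a $ j * t j) = (a :: int) * t i"
proof -
  have "(\<Sum>j\<in>UNIV. axis i a $ j * t j) = (\<Sum>j\<in>UNIV. if j = i then a * t i else 0)"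
    by (intro sum.cong) (auto simp: axis_def)
  then show ?thesis by simp
qed

lemma shear_mult: "shear k \<phi> *v t = t + axis k (\<Sum>j\<in>UNIV. \<phi> $ j * t $ j)"
  by (simp add: vec_eq_iff shear_def matrix_vector_mult_def distrib_right sum.distrib sum_axis_mult)
    (simp add: axis_def)

text \<open>A shear is obtained from the identity by adding multiples of other rows to row \<open>k\<close>, one at a time.\<close>

lemma det_shear:
  assumes "\<phi> $ k = 0" shows "det (shear k \<phi>) = 1"
proof -
  have "det (shear k (\<Sum>j\<in>J. axis j (\<phi> $ j))) = 1" if "finite J" "k \<notin> J" for J
    using that
  proof (induction J)
    case empty
    have "shear k (\<Sum>j\<in>{}. axis j (\<phi> $ j)) = mat 1"
      by (simp add: shear_def mat_def axis_def vec_eq_iff)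
    then show ?case by simp
  next
    case (insert l J)
    define A where "A = shear k (\<Sum>j\<in>J. axis j (\<phi> $ j))"
    have "shear k (\<Sum>j\<in>insert l J. axis j (\<phi> $ j)) =
        (\<chi> i. if i = k then row k A + \<phi> $ l *s row l A else row i A)"
      using insert by (auto simp: A_def shear_def row_def vec_eq_iff axis_def)
    then show ?case using insert det_row_operation[of k l A "\<phi> $ l"] by (auto simp: A_def)
  qed
  from this[of "UNIV - {k}"] have "det (shear k (\<Sum>j\<in>UNIV - {k}. axis j (\<phi> $ j))) = 1" by simp
  moreover have "(\<Sum>j\<in>UNIV - {k}. axis j (\<phi> $ j)) = \<phi>"
  proof -
    have "(\<Sum>j\<in>UNIV. axis j (\<phi> $ j)) = \<phi>" by (simp add: vec_eq_iff axis_def)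
    moreover have "axis k (\<phi> $ k) = 0" using assms by (simp add: vec_eq_iff axis_def)
    ultimately show ?thesis by (simp add: sum.remove[of UNIV k])
  qed
  ultimately show ?thesis by simp
qed

text \<open>The Euclidean algorithm: elementary shears subtract coordinates from each other until only one
coordinate is left. Quarter turns in coordinate planes, which are products of shears, move the remaining
entry to position \<open>k\<close> and correct its sign. The number \<open>c\<close> is the greatest common divisor of the
coordinates of \<open>x\<close>.\<close>

lemma SL_orbit_axis:
  fixes x :: "int ^ 'd"
  assumes "x \<noteq> 0" "CARD('d) \<ge> 2"
  obtains c A where "c \<ge> 1" "det A = 1" "A *v axis k c = x"
proof -
  define reach where "reach x \<longleftrightarrow> (\<exists>c A. c \<ge> 1 \<and> det A = 1 \<and> A *v axis k c = x)" for x :: "int ^ 'd"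
  \<comment> \<open>The inverse of an elementary shear is again one, so it suffices to reach the sheared vector.\<close>
  have step: "reach x" if r: "reach (x + axis i (m * x $ l))" and ne: "i \<noteq> l" for x i l m
  proof -
    obtain c A where A: "c \<ge> 1" "det A = 1" "A *v axis k c = x + axis i (m * x $ l)"
      using r unfolding reach_def by blast
    define S where "S = shear i (axis l (- m))"
    have "det S = 1" unfolding S_def using ne by (intro det_shear) (simp add: axis_def)
    then have "det (S ** A) = 1" using A by (simp add: det_mul)
    moreover have "(S ** A) *v axis k c = x"
    proof -
      have "(\<Sum>j\<in>UNIV. axis l (- m) $ j * (x + axis i (m * x $ l)) $ j) = - m * x $ l"
        unfolding sum_axis_mult using ne by (simp add: axis_def)
      then show ?thesis
        unfolding matrix_vector_mul_assoc[symmetric] A(3) unfolding S_def shear_mult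
        by (simp add: vec_eq_iff axis_def)
    qed
    ultimately show ?thesis using A(1) unfolding reach_def by blast
  qed
  have swap: "reach (axis i a)" if "reach (axis l a)" "i \<noteq> l" for i l :: 'd and a
  proof -
    have eq: "axis i a + axis l a + axis i (- a) = axis l a" by (simp add: vec_eq_iff axis_def)
    have l: "(axis i a + axis l a) $ l = a" using that(2) by (simp add: axis_def)
    have "reach (axis i a + axis l a)"
      by (rule step[of _ i "-1" l]) (use that in \<open>simp_all only: l eq mult_minus1 not_False_eq_True\<close>)
    then have "reach (axis i a + axis l (1 * axis i a $ i))" by (simp add: axis_nth)
    then show ?thesis by (rule step) (use that in simp)
  qed
  have axis_pos: "reach (axis i a)" if "a > 0" for i a
  proof -
    have "reach (axis k a)" unfolding reach_def using that
      by (intro exI[of _ a] exI[of _ "mat 1"]) auto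
    then show ?thesis using swap by (cases "i = k") auto
  qed
  have axis_all: "reach (axis i a)" if "a \<noteq> 0" for i a
  proof (cases "a > 0")
    case False
    have "UNIV \<noteq> {i}" using assms(2) by (metis card_1_singleton_iff Suc_1 not_less_eq_eq le_refl One_nat_def)
    then obtain l where "l \<noteq> i" by auto
    then have l: "l \<noteq> i" "i \<noteq> l" by auto
    have r: "reach (axis l (- a))" using False that by (intro axis_pos) auto
    have eq: "axis i a + axis l (- a) + axis i (- a) = axis l (- a)"
      by (simp add: vec_eq_iff axis_def)
    have nth: "(axis i a + axis l (- a)) $ l = - a" using l by (simp add: axis_def)
    have "reach (axis i a + axis l (- a))"
      by (rule step[of _ i 1 l]) (use l r in \<open>simp_all only: mult_1_left not_False_eq_True eq nth\<close>)
    then have "reach (axis i a + axis l (- 1 * axis i a $ i))" by (simp add: axis_nth)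
    then show ?thesis by (rule step) (use l in simp)
  qed (rule axis_pos)
  have "reach x"
    using assms(1)
  proof (induction "nat (\<Sum>i\<in>UNIV. \<bar>x $ i\<bar>)" arbitrary: x rule: less_induct)
    case less
    obtain i0 where i0: "x $ i0 \<noteq> 0" using less.prems by (auto simp: vec_eq_iff)
    show ?case
    proof (cases "\<exists>j. j \<noteq> i0 \<and> x $ j \<noteq> 0")
      case False
      then have "x = axis i0 (x $ i0)" by (auto simp: vec_eq_iff axis_def)
      then show ?thesis using axis_all[OF i0, of i0] by simp
    next
      case True
      then obtain j where j: "j \<noteq> i0" "x $ j \<noteq> 0" by blast
      obtain i l where il: "i \<noteq> l" "x $ l \<noteq> 0" "\<bar>x $ l\<bar> \<le> \<bar>x $ i\<bar>"
        using i0 j by (cases "\<bar>x $ j\<bar> \<le> \<bar>x $ i0\<bar>") (metis, metis linear)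
      define m where "m = - sgn (x $ i) * sgn (x $ l)"
      define x' where "x' = x + axis i (m * x $ l)"
      have x'_nth: "x' $ j = (if j = i then x $ i + m * x $ l else x $ j)" for j
        by (auto simp: x'_def axis_def)
      have "\<bar>x' $ i\<bar> < \<bar>x $ i\<bar>"
        using il unfolding x'_nth m_def by (auto simp: sgn_if)
      moreover have "(\<Sum>j\<in>UNIV. \<bar>x' $ j\<bar>) = \<bar>x' $ i\<bar> + (\<Sum>j\<in>UNIV - {i}. \<bar>x $ j\<bar>)"
        by (subst sum.remove[of _ i]) (auto simp: x'_nth intro!: sum.cong)
      moreover have "(\<Sum>j\<in>UNIV. \<bar>x $ j\<bar>) = \<bar>x $ i\<bar> + (\<Sum>j\<in>UNIV - {i}. \<bar>x $ j\<bar>)"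
        by (subst sum.remove[of _ i]) auto
      moreover have "0 \<le> (\<Sum>j\<in>UNIV. \<bar>x' $ j\<bar>)" by (intro sum_nonneg) auto
      ultimately have "nat (\<Sum>j\<in>UNIV. \<bar>x' $ j\<bar>) < nat (\<Sum>j\<in>UNIV. \<bar>x $ j\<bar>)" by linarith
      moreover have "x' \<noteq> 0"
      proof
        assume "x' = 0"
        then have "x' $ l = 0" by simp
        then show False using il by (simp add: x'_nth)
      qed
      ultimately have "reach x'" by (rule less.hyps)
      then show ?thesis unfolding x'_def using il(1) by (rule step)
    qed
  qed
  then show ?thesis using that unfolding reach_def by blast
qed

text \<open>Telescoping, by comparing \<open>1/q\<^sup>3\<close> with \<open>1/((q - 1) q (q + 1))\<close>.\<close>

lemma sum_inverse_cubes_le: "(\<Sum>q=2..N. 1 / real q ^ 3) \<le> 1 / 4"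
proof -
  have identity: "1 / (2 * x * (x + 1)) - 1 / (2 * (x + 1) * (x + 2)) = 1 / (x * (x + 1) * (x + 2))"
    if "x > 0" for x :: real
  proof -
    have "x + 1 \<noteq> 0" "x + 2 \<noteq> 0" "x \<noteq> 0" using that by auto
    then show ?thesis by (simp add: divide_simps) (simp add: algebra_simps)
  qed
  have "(\<Sum>q=2..N. 1 / real q ^ 3) \<le> 1 / 4 - 1 / (2 * real N * (real N + 1))" if "N \<ge> 1"
    using that
  proof (induction N rule: dec_induct)
    case (step n)
    have "1 / real (Suc n) ^ 3 \<le> 1 / (2 * real n * (real n + 1)) - 1 / (2 * real (Suc n) * (real (Suc n) + 1))"
    proof -
      have "1 / (2 * real n * (real n + 1)) - 1 / (2 * real (Suc n) * (real (Suc n) + 1))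
          = 1 / (real n * real (Suc n) * (real n + 2))"
        using step identity[of "real n"] by (simp add: add.commute)
      moreover have "real n * real (Suc n) * (real n + 2) \<le> real (Suc n) ^ 3"
        by (simp add: power3_eq_cube algebra_simps)
      moreover have "real n * real (Suc n) * (real n + 2) > 0" using step by simp
      ultimately show ?thesis by (simp add: frac_le)
    qed
    then show ?case using step by simp
  qed simp
  also have "1 / 4 - 1 / (2 * real N * (real N + 1)) \<le> 1 / 4" by simp
  finally show ?thesis by (cases "N \<ge> 1") auto
qed

text \<open>A union bound over the possible common divisors \<open>q\<close>: at most \<open>(N/q)\<^sup>d\<close> vectors of the cube are
divisible by \<open>q\<close>. For \<open>d \<ge> 3\<close> the sum over \<open>q\<close> is small enough for primitive vectors to be in the
majority.\<close>

lemma card_imprimitive_le: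
  assumes "CARD('d) \<ge> 3"
  shows "real (card {x \<in> cube N :: (int ^ 'd) set. \<exists>q\<in>{2..N}. \<forall>i. int q dvd x $ i}) \<le> real N ^ CARD('d) / 4"
proof -
  let ?d = "CARD('d)"
  let ?X = "\<lambda>q. {x :: int ^ 'd. \<forall>i. x $ i \<in> (\<lambda>m. int q * m) ` {1..int (N div q)}}"
  have "{x \<in> cube N :: (int ^ 'd) set. \<exists>q\<in>{2..N}. \<forall>i. int q dvd x $ i} \<subseteq> (\<Union>q\<in>{2..N}. ?X q)"
  proof
    fix x :: "int ^ 'd" assume "x \<in> {x \<in> cube N. \<exists>q\<in>{2..N}. \<forall>i. int q dvd x $ i}"
    then obtain q where q: "q \<in> {2..N}" "\<And>i. int q dvd x $ i" and x: "\<And>i. 1 \<le> x $ i" "\<And>i. x $ i \<le> int N"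
      by (auto simp: cube_def)
    have "x $ i \<in> (\<lambda>m. int q * m) ` {1..int (N div q)}" for i
    proof -
      obtain m where m: "x $ i = int q * m" using q(2) by (auto simp: dvd_def)
      have "0 < int q" using q(1) by simp
      moreover have "0 < int q * m" using x(1)[of i] m by simp
      ultimately have "1 \<le> m" by (simp add: zero_less_mult_iff)
      moreover have "m \<le> int (N div q)"
      proof -
        have "m = x $ i div int q" using m \<open>0 < int q\<close> by simp
        also have "\<dots> \<le> int N div int q" using x(2) \<open>0 < int q\<close> by (intro zdiv_mono1) auto
        finally show ?thesis by (simp add: zdiv_int)
      qed
      ultimately show ?thesis using m by auto
    qed
    then show "x \<in> (\<Union>q\<in>{2..N}. ?X q)" using q(1) by blast
  qed
  moreover have "finite (?X q)" for q by (intro card_vec_Collect) auto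
  ultimately have "card {x \<in> cube N :: (int ^ 'd) set. \<exists>q\<in>{2..N}. \<forall>i. int q dvd x $ i} \<le> card (\<Union>q\<in>{2..N}. ?X q)"
    by (intro card_mono) auto
  also have "\<dots> \<le> (\<Sum>q\<in>{2..N}. card (?X q))" by (rule card_UN_le) simp
  also have "\<dots> = (\<Sum>q\<in>{2..N}. (N div q) ^ ?d)"
  proof (intro sum.cong refl)
    fix q assume "q \<in> {2..N}"
    then have "inj_on (\<lambda>m. int q * m) {1..int (N div q)}" by (auto simp: inj_on_def)
    then show "card (?X q) = (N div q) ^ ?d" by (subst card_vec_Collect) (auto simp: card_image)
  qed
  finally have "real (card {x \<in> cube N :: (int ^ 'd) set. \<exists>q\<in>{2..N}. \<forall>i. int q dvd x $ i})
      \<le> (\<Sum>q\<in>{2..N}. real (N div q) ^ ?d)"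
    by (simp only: of_nat_power[symmetric] of_nat_sum[symmetric] of_nat_le_iff)
  also have "\<dots> \<le> (\<Sum>q\<in>{2..N}. real N ^ ?d * (1 / real q ^ 3))"
  proof (intro sum_mono)
    fix q assume q: "q \<in> {2..N}"
    have "real (N div q) ^ ?d \<le> (real N / real q) ^ ?d"
      by (intro power_mono) (auto simp: of_nat_div_le_of_nat)
    also have "\<dots> = real N ^ ?d * (1 / real q ^ ?d)" by (simp add: power_divide)
    also have "\<dots> \<le> real N ^ ?d * (1 / real q ^ 3)"
      using q assms by (intro mult_left_mono divide_left_mono power_increasing) auto
    finally show "real (N div q) ^ ?d \<le> real N ^ ?d * (1 / real q ^ 3)" .
  qed
  also have "\<dots> = real N ^ ?d * (\<Sum>q\<in>{2..N}. 1 / real q ^ 3)" by (simp add: sum_distrib_left)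
  also have "\<dots> \<le> real N ^ ?d * (1 / 4)" by (intro mult_left_mono sum_inverse_cubes_le) auto
  finally show ?thesis by simp
qed

section \<open>Vanishing correlations\<close>

locale SL_invariant_field = lattice_action M T
  for M :: "'a measure" and T :: "int ^ 'd \<Rightarrow> 'a \<Rightarrow> 'a" +
  fixes g :: "'a \<Rightarrow> real"
  assumes g_bm: "g \<in> bounded_measurable M"
    and g_mean: "expectation g = 0"
    and SL_invariant: "\<lbrakk>det A = 1; finite V\<rbrakk> \<Longrightarrow>
      expectation (\<lambda>y. \<Prod>v\<in>V. g (T (A *v v) y)) = expectation (\<lambda>y. \<Prod>v\<in>V. g (T v y))"
    and card_ge_3: "CARD('d) \<ge> 3"
    and wm: "weakly_mixing"
begin

lemma monomial_bm: "(\<lambda>y. \<Prod>i\<in>I. g (T (t i) y)) \<in> bounded_measurable M"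
  by (intro bounded_measurable_intros bounded_measurable_T g_bm)

text \<open>Averages of the correlation of \<open>n m x\<close>, \<open>n \<in> S\<close>, over \<open>x\<close> in a cube tend to zero by weak mixing. For
primitive \<open>x\<close> the correlation equals \<open>\<Psi> m\<close>, and these \<open>x\<close> make up at least three quarters of
the cube; for all other \<open>x\<close> it is some \<open>\<Psi> (m * c)\<close>. So every bound \<open>s\<close> for \<open>\<Psi>\<close> improves to \<open>s / 3\<close>, and
iteration shows that \<open>\<Psi>\<close> vanishes.\<close>

proposition collinear_correlation_zero:
  fixes S :: "int set" and k :: 'd
  assumes "finite S" "S \<noteq> {}"
  shows "expectation (\<lambda>y. \<Prod>n\<in>S. g (T (axis k n) y)) = 0"
proof -
  define \<Psi> where "\<Psi> c = expectation (\<lambda>y. \<Prod>n\<in>S. g (T (axis k (n * c)) y))" for c :: int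
  have contract: "\<bar>\<Psi> m\<bar> \<le> s / 3" if s: "\<And>c. c \<ge> 1 \<Longrightarrow> \<bar>\<Psi> c\<bar> \<le> s" and "m \<ge> 1" for s m
  proof -
    define \<alpha> where "\<alpha> x = expectation (\<lambda>y. \<Prod>n\<in>S. g (T ((n * m) *s x) y))" for x :: "int ^ 'd"
    obtain j where j: "j \<in> S" using assms by blast
    have lim: "(\<lambda>N. cube_average N \<alpha>) \<longlonglongrightarrow> 0"
      unfolding \<alpha>_def
      by (rule van_der_Corput_average[OF weakly_mixing_decorrelating[OF wm] assms(1) j])
        (use g_bm g_mean \<open>m \<ge> 1\<close> in auto)
    have \<alpha>_orbit: "\<alpha> (A *v axis k c) = \<Psi> (m * c)" if "det A = 1" "c \<ge> 1" for A c
    proof -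
      define V where "V = (\<lambda>n. axis k (n * (m * c))) ` S"
      have inj: "inj_on (\<lambda>n. axis k (n * (m * c))) S"
        using \<open>m \<ge> 1\<close> \<open>c \<ge> 1\<close> by (auto simp: inj_on_def axis_eq_axis)
      have "(n * m) *s (A *v axis k c) = A *v axis k (n * (m * c))" for n
      proof -
        have "(n * m) *s (A *v axis k c) = A *v ((n * m) *s axis k c)"
          by (simp add: vec_eq_iff matrix_vector_mult_def sum_distrib_left mult_ac)
        also have "(n * m) *s axis k c = axis k (n * (m * c))" by (simp add: vec_eq_iff axis_def)
        finally show ?thesis .
      qed
      then have "\<alpha> (A *v axis k c) = expectation (\<lambda>y. \<Prod>v\<in>V. g (T (A *v v) y))"
        unfolding \<alpha>_def V_def by (simp add: prod.reindex[OF inj])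
      also have "\<dots> = expectation (\<lambda>y. \<Prod>v\<in>V. g (T v y))"
        using that(1) assms(1) by (intro SL_invariant) (auto simp: V_def)
      also have "\<dots> = \<Psi> (m * c)" unfolding \<Psi>_def V_def by (simp add: prod.reindex[OF inj])
      finally show ?thesis .
    qed
    have bound: "3 * \<bar>\<Psi> m\<bar> / 4 \<le> \<bar>cube_average N \<alpha>\<bar> + s / 4" if "N > 0" for N
    proof -
      let ?d = "CARD('d)"
      let ?B = "cube N :: (int ^ 'd) set"
      let ?I = "{x \<in> ?B. \<exists>q\<in>{2..N}. \<forall>i. int q dvd x $ i}"
      have val: "\<exists>c\<ge>1. \<alpha> x = \<Psi> (m * c) \<and> (x \<notin> ?I \<longrightarrow> c = 1)" if x: "x \<in> ?B" for x
      proof -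
        have "x \<noteq> 0" using x by (auto simp: cube_def)
        moreover have "CARD('d) \<ge> 2" using card_ge_3 by simp
        ultimately obtain c A where c: "c \<ge> 1" "det A = 1" "A *v axis k c = x"
          by (rule SL_orbit_axis)
        have dvd: "c dvd x $ i" for i
        proof -
          have "x $ i = A $ i $ k * c"
            unfolding c(3)[symmetric] using sum_axis_mult[of k c "\<lambda>j. A $ i $ j"]
            by (simp add: matrix_vector_mult_def mult.commute)
          then show ?thesis by simp
        qed
        have "c = 1" if "x \<notin> ?I"
        proof (rule ccontr)
          assume "c \<noteq> 1"
          have "1 \<le> x $ k" using x by (simp add: cube_def)
          then have "c \<le> x $ k" using dvd[of k] by (intro zdvd_imp_le) auto
          also have "x $ k \<le> int N" using x by (simp add: cube_def)
          finally have "nat c \<in> {2..N}" using c(1) \<open>c \<noteq> 1\<close> by auto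
          moreover have "\<forall>i. int (nat c) dvd x $ i" using dvd c(1) by simp
          ultimately show False using that x by blast
        qed
        then show ?thesis using \<alpha>_orbit[OF c(2,1)] c by auto
      qed
      have s0: "s \<ge> 0" using s[of 1] by simp
      have cardI: "real (card ?I) \<le> real N ^ ?d / 4" by (rule card_imprimitive_le[OF card_ge_3])
      have "sum \<alpha> ?B = sum \<alpha> (?B - ?I) + sum \<alpha> ?I"
        by (rule sum.subset_diff) auto
      also have "sum \<alpha> (?B - ?I) = (\<Sum>x\<in>?B - ?I. \<Psi> m)"
        using val by (intro sum.cong refl) fastforce
      also have "\<dots> = real (card (?B - ?I)) * \<Psi> m" by simp
      finally have "real (card (?B - ?I)) * \<bar>\<Psi> m\<bar> \<le> \<bar>sum \<alpha> ?B\<bar> + \<bar>sum \<alpha> ?I\<bar>"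
        by (simp add: abs_mult[symmetric, of "real _", simplified])
      also have "\<bar>sum \<alpha> ?I\<bar> \<le> real (card ?I) * s"
      proof -
        have "\<bar>\<alpha> x\<bar> \<le> s" if x: "x \<in> ?I" for x
        proof -
          obtain c where "c \<ge> 1" "\<alpha> x = \<Psi> (m * c)" using val[of x] x by blast
          moreover have "m * c \<ge> 1" using \<open>m \<ge> 1\<close> \<open>c \<ge> 1\<close> mult_mono[of 1 m 1 c] by simp
          ultimately show ?thesis using s by simp
        qed
        then show ?thesis using order_trans[OF sum_abs sum_bounded_above[of ?I "\<lambda>x. \<bar>\<alpha> x\<bar>" s]] by simp
      qed
      also have "\<dots> \<le> real N ^ ?d / 4 * s" using cardI s0 by (intro mult_right_mono)
      finally have 1: "real (card (?B - ?I)) * \<bar>\<Psi> m\<bar> \<le> \<bar>sum \<alpha> ?B\<bar> + real N ^ ?d / 4 * s" by simp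
      have "real (card (?B - ?I)) = real N ^ ?d - real (card ?I)"
        using card_mono[of ?B ?I] by (subst card_Diff_subset) (auto simp: card_cube of_nat_diff)
      then have "3 / 4 * real N ^ ?d \<le> real (card (?B - ?I))" using cardI by simp
      then have "3 / 4 * real N ^ ?d * \<bar>\<Psi> m\<bar> \<le> \<bar>sum \<alpha> ?B\<bar> + real N ^ ?d / 4 * s"
        using 1 by (meson abs_ge_zero mult_right_mono order_trans)
      then have "(3 / 4 * real N ^ ?d * \<bar>\<Psi> m\<bar>) / real N ^ ?d \<le> (\<bar>sum \<alpha> ?B\<bar> + real N ^ ?d / 4 * s) / real N ^ ?d"
        by (intro divide_right_mono) auto
      then show ?thesis using that by (simp add: cube_average_def add_divide_distrib)
    qed
    have "(\<lambda>N. \<bar>cube_average N \<alpha>\<bar> + s / 4) \<longlonglongrightarrow> \<bar>0\<bar> + s / 4"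
      by (intro tendsto_intros lim)
    moreover have "\<forall>\<^sub>F N in sequentially. 3 * \<bar>\<Psi> m\<bar> / 4 \<le> \<bar>cube_average N \<alpha>\<bar> + s / 4"
      using eventually_gt_at_top[of 0] by eventually_elim (rule bound)
    ultimately have "3 * \<bar>\<Psi> m\<bar> / 4 \<le> \<bar>0\<bar> + s / 4"
      by (intro tendsto_lowerbound) auto
    then show ?thesis by simp
  qed
  obtain K where K: "K \<ge> 1" "\<And>y. y \<in> space M \<Longrightarrow> \<bar>g y\<bar> \<le> K"
    using bounded_measurable_bound[OF g_bm] by metis
  have "\<bar>\<Psi> c\<bar> \<le> K ^ card S" for c
    unfolding \<Psi>_def
  proof (rule expectation_abs_le[OF monomial_bm])
    fix y assume "y \<in> space M"
    then have "(\<Prod>n\<in>S. \<bar>g (T (axis k (n * c)) y)\<bar>) \<le> (\<Prod>n\<in>S. K)"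
      using K T_space by (intro prod_mono) auto
    then show "\<bar>\<Prod>n\<in>S. g (T (axis k (n * c)) y)\<bar> \<le> K ^ card S" by (simp add: abs_prod)
  qed
  then have "\<bar>\<Psi> c\<bar> \<le> K ^ card S / 3 ^ n" if "c \<ge> 1" for n c
    using that
  proof (induction n arbitrary: c)
    case (Suc n)
    then show ?case using contract[of "K ^ card S / 3 ^ n" c] by (simp add: mult.commute)
  qed simp
  then have "\<bar>\<Psi> 1\<bar> \<le> K ^ card S / 3 ^ n" for n by simp
  moreover have "(\<lambda>n. K ^ card S / 3 ^ n) \<longlonglongrightarrow> 0"
    by (rule LIMSEQ_divide_realpow_zero) simp
  ultimately have "\<bar>\<Psi> 1\<bar> \<le> 0" using LIMSEQ_le_const by blast
  then show ?thesis by (simp add: \<Psi>_def)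
qed

end

text \<open>Finitely many nonzero vectors lie outside the kernel of a common functional. To repair \<open>\<phi>\<close> at a new
vector \<open>v\<close> in its kernel, add \<open>v\<close> to a multiple of \<open>\<phi>\<close> that is large enough not to affect the old ones.\<close>

lemma functional_avoiding_kernels:
  fixes D :: "(int ^ 'd) set"
  assumes "finite D" "0 \<notin> D"
  shows "\<exists>\<phi> :: int ^ 'd. \<forall>w\<in>D. (\<Sum>j\<in>UNIV. \<phi> $ j * w $ j) \<noteq> 0"
  using assms
proof (induction D)
  case (insert v D)
  then obtain \<phi> :: "int ^ 'd" where \<phi>: "\<And>w. w \<in> D \<Longrightarrow> (\<Sum>j\<in>UNIV. \<phi> $ j * w $ j) \<noteq> 0" by auto
  define p where "p \<psi> w = (\<Sum>j\<in>UNIV. \<psi> $ j * w $ j)" for \<psi> w :: "int ^ 'd"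
  have p_add: "p (m *s \<psi> + \<psi>') w = m * p \<psi> w + p \<psi>' w" for m \<psi> \<psi>' w
    by (simp add: p_def sum.distrib sum_distrib_left algebra_simps)
  show ?case
  proof (cases "p \<phi> v = 0")
    case False
    then show ?thesis using \<phi> by (intro exI[of _ \<phi>]) (auto simp: p_def)
  next
    case True
    define m where "m = 1 + (\<Sum>w\<in>D. \<bar>p v w\<bar>)"
    have "p (m *s \<phi> + v) w \<noteq> 0" if "w \<in> D" for w
    proof
      assume "p (m *s \<phi> + v) w = 0"
      then have "m * p \<phi> w = - p v w" by (simp add: p_add)
      then have eq: "\<bar>m\<bar> * \<bar>p \<phi> w\<bar> = \<bar>p v w\<bar>" by (metis abs_minus abs_mult)
      have "\<bar>p v w\<bar> \<le> (\<Sum>w\<in>D. \<bar>p v w\<bar>)" using that insert.hyps by (intro member_le_sum) auto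
      then have m: "\<bar>p v w\<bar> < m" by (simp add: m_def)
      have "1 \<le> \<bar>p \<phi> w\<bar>" using \<phi>[OF that] by (simp add: p_def)
      then have "\<bar>m\<bar> * 1 \<le> \<bar>m\<bar> * \<bar>p \<phi> w\<bar>" by (intro mult_left_mono) auto
      then show False using eq m by simp
    qed
    moreover have "p (m *s \<phi> + v) v \<noteq> 0"
    proof -
      obtain i where i: "v $ i \<noteq> 0" using insert.prems by (auto simp: vec_eq_iff)
      have "p v v > 0" unfolding p_def using i by (intro sum_pos2[of _ i]) (auto simp: zero_less_mult_iff)
      then show ?thesis using True by (simp add: p_add)
    qed
    ultimately show ?thesis by (intro exI[of _ "m *s \<phi> + v"]) (auto simp: p_def)
  qed
qed auto

lemma axis_add: "axis k (m + n :: int) = axis k m + axis k n"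
  by (simp add: vec_eq_iff axis_def)

lemma axis_zero: "axis k (0 :: int) = 0"
  by (simp add: vec_eq_iff axis_def)

context SL_invariant_field
begin

lemma line_correlation_zero:
  assumes "finite S" "S \<noteq> {}"
  shows "expectation (\<lambda>y. \<Prod>n\<in>S. g (T (v0 + axis k n) y)) = 0"
proof -
  have "expectation (\<lambda>y. \<Prod>n\<in>S. g (T (v0 + axis k n) y))
      = expectation (\<lambda>y. \<Prod>n\<in>S. g (T (axis k n) (T v0 y)))"
    by (intro Bochner_Integration.integral_cong refl prod.cong) (simp add: T_add[symmetric] add.commute)
  also have "\<dots> = expectation (\<lambda>y. \<Prod>n\<in>S. g (T (axis k n) y))"
    by (rule integral_T[OF bounded_measurable_measurable[OF monomial_bm]])
  finally show ?thesis by (simp add: collinear_correlation_zero assms)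
qed

text \<open>The translations along \<open>e\<^sub>k\<close> form an action of the integers. Letting the lattice act through its
\<open>k\<close>-th coordinate makes the averages over cubes available for it.\<close>

lemma lattice_action_axis: "lattice_action M (\<lambda>x. T (axis k (x $ k)))"
proof
  fix v w :: "int ^ 'd" and y assume y: "y \<in> space M"
  show "T (axis k ((v + w) $ k)) y = T (axis k (v $ k)) (T (axis k (w $ k)) y)"
    by (simp add: axis_add T_add[OF y])
next
  fix y assume "y \<in> space M"
  then show "T (axis k ((0 :: int ^ 'd) $ k)) y = y" by (simp add: axis_zero T_zero)
qed (auto simp: T_preserves)

text \<open>Take \<open>n\<close> translates along the line, with uniform weights and at distances larger than the diameter
of \<open>S\<close>. The product of two different ones is again a product over distinct points of the line, and so
exactly in the class; the pairs of equal translates have total weight \<open>1/n\<close>. All these products have mean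
zero by the collinear case.\<close>

lemma line_monomials_decorrelating:
  "lattice_action.decorrelating M (\<lambda>x. T (axis k (x $ k)))
    {\<lambda>y. \<Prod>n\<in>S. g (T (v0 + axis k n) y) | S. finite S \<and> S \<noteq> {}}" (is "lattice_action.decorrelating M ?T ?A")
proof -
  interpret L: lattice_action M ?T by (rule lattice_action_axis)
  define mono where "mono S y = (\<Prod>n\<in>S. g (T (v0 + axis k n) y))" for S y
  have mono_bm: "mono S \<in> bounded_measurable M" for S unfolding mono_def by (rule monomial_bm)
  have mono_A: "mono S \<in> ?A" if "finite S" "S \<noteq> {}" for S
  proof -
    have "mono S = (\<lambda>y. \<Prod>n\<in>S. g (T (v0 + axis k n) y))" by (simp add: fun_eq_iff mono_def)
    then show ?thesis using that by blast
  qed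
  show ?thesis
    unfolding L.decorrelating_def
  proof (intro ballI conjI allI impI)
    fix f assume "f \<in> ?A"
    then obtain S where S: "finite S" "S \<noteq> {}" and f: "f = mono S"
      by (auto simp: mono_def fun_eq_iff)
    show "f \<in> bounded_measurable M" using f mono_bm by simp
    show "expectation f = 0" using line_correlation_zero[OF S] unfolding f mono_def .
    fix b :: int and \<epsilon> :: real assume "b \<noteq> 0" "\<epsilon> > 0"
    obtain B where B: "B \<ge> 1" "\<And>y. y \<in> space M \<Longrightarrow> \<bar>f y\<bar> \<le> B"
      using bounded_measurable_bound[OF mono_bm[of S]] unfolding f by metis
    obtain n :: nat where n: "B\<^sup>2 / \<epsilon> < real n" using reals_Archimedean2 by blast
    have "0 \<le> B\<^sup>2 / \<epsilon>" using \<open>\<epsilon> > 0\<close> by simp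
    then have n_pos: "n > 0" using n by (metis of_nat_0_less_iff le_less_trans)
    define R where "R = 1 + Max S - Min S"
    have R: "\<bar>s - s'\<bar> < R" if "s \<in> S" "s' \<in> S" for s s'
    proof -
      have "s \<le> Max S" "s' \<le> Max S" "Min S \<le> s" "Min S \<le> s'" using S that by auto
      then show ?thesis by (simp add: R_def)
    qed
    define H where "H = (\<lambda>m. axis k (int m * R) :: int ^ 'd) ` {..<n}"
    have R_pos: "R > 0" using R S by force
    have injH: "inj_on (\<lambda>m. axis k (int m * R) :: int ^ 'd) {..<n}"
      using R_pos by (auto simp: inj_on_def axis_eq_axis)
    have cardH: "card H = n" unfolding H_def by (simp add: card_image[OF injH])
    have finH: "finite H" by (simp add: H_def)
    define c where "c h = (if h \<in> H then 1 / real n else 0)" for h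
    define sh where "sh h = (\<lambda>s. s + b * h $ k) ` S" for h :: "int ^ 'd"
    define q where "q h h' = (if h = h' then (\<lambda>_. 0) else mono (sh h \<union> sh h'))" for h h'
    define e where "e h h' = (if h = h' then B\<^sup>2 else 0)" for h h' :: "int ^ 'd"
    have W: "weights H c" using n_pos cardH finH by (auto simp: weights_def c_def)
    have shift: "f (T (axis k (b * h $ k)) y) = mono (sh h) y" if "y \<in> space M" for h y
    proof -
      have "f (T (axis k (b * h $ k)) y) = (\<Prod>s\<in>S. g (T (v0 + axis k (s + b * h $ k)) y))"
        unfolding f mono_def using that
        by (intro prod.cong refl) (simp add: T_add[symmetric] axis_add add.assoc)
      also have "\<dots> = mono (sh h) y"
        unfolding mono_def sh_def by (subst prod.reindex) (auto simp: inj_on_def)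
      finally show ?thesis .
    qed
    have disj: "sh h \<inter> sh h' = {}" if "h \<in> H" "h' \<in> H" "h \<noteq> h'" for h h'
    proof (rule ccontr)
      assume "sh h \<inter> sh h' \<noteq> {}"
      then obtain s s' where s: "s \<in> S" "s' \<in> S" "s + b * h $ k = s' + b * h' $ k"
        by (auto simp: sh_def)
      obtain m m' where m: "h = axis k (int m * R)" "h' = axis k (int m' * R)"
        using \<open>h \<in> H\<close> \<open>h' \<in> H\<close> by (auto simp: H_def)
      then have "m \<noteq> m'" using that by auto
      have "s - s' = b * (int m' - int m) * R" using s(3) m by (simp add: algebra_simps)
      then have eq: "\<bar>s - s'\<bar> = \<bar>b * (int m' - int m)\<bar> * R" using R_pos by (simp add: abs_mult)
      have "b * (int m' - int m) \<noteq> 0" using \<open>b \<noteq> 0\<close> \<open>m \<noteq> m'\<close> by simp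
      then have "1 \<le> \<bar>b * (int m' - int m)\<bar>" by arith
      then have "1 * R \<le> \<bar>b * (int m' - int m)\<bar> * R" using R_pos by (intro mult_right_mono) auto
      then show False using eq R[OF s(1,2)] by simp
    qed
    have "(q h h' \<in> ?A \<or> q h h' = (\<lambda>_. 0)) \<and>
        (\<forall>y\<in>space M. \<bar>f (?T (b *s h) y) * f (?T (b *s h') y) - q h h' y\<bar> \<le> e h h')"
      if "h \<in> H" "h' \<in> H" for h h'
    proof (cases "h = h'")
      case True
      have "\<bar>f (T (axis k m) y) * f (T (axis k m) y)\<bar> \<le> B\<^sup>2" if "y \<in> space M" for m y
        unfolding abs_mult power2_eq_square using B T_space[OF that] by (intro mult_mono) auto
      then show ?thesis using True by (auto simp: q_def e_def)
    next
      case False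
      have "finite (sh h \<union> sh h')" "sh h \<union> sh h' \<noteq> {}" using S by (auto simp: sh_def)
      then have "q h h' \<in> ?A" using mono_A False unfolding q_def by simp
      moreover have "mono (sh h \<union> sh h') y = mono (sh h) y * mono (sh h') y" for y
        unfolding mono_def using S disj[OF that False]
        by (intro prod.union_disjoint) (auto simp: sh_def)
      ultimately show ?thesis using False by (simp add: shift q_def e_def)
    qed
    moreover have "(\<Sum>h\<in>H. \<Sum>h'\<in>H. c h * c h' * e h h') < \<epsilon>"
    proof -
      have "(\<Sum>h\<in>H. \<Sum>h'\<in>H. c h * c h' * e h h') = (\<Sum>h\<in>H. \<Sum>h'\<in>H. if h = h' then B\<^sup>2 / (real n)\<^sup>2 else 0)"
        by (intro sum.cong refl) (simp add: c_def e_def power2_eq_square)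
      also have "\<dots> = B\<^sup>2 / real n" using finH cardH n_pos by (simp add: power2_eq_square)
      also have "\<dots> < \<epsilon>" using n n_pos \<open>\<epsilon> > 0\<close> by (simp add: field_simps)
      finally show ?thesis .
    qed
    ultimately show "\<exists>S c q e. weights S c \<and>
      (\<forall>h\<in>S. \<forall>k'\<in>S. (q h k' \<in> ?A \<or> q h k' = (\<lambda>_. 0)) \<and>
        (\<forall>x\<in>space M. \<bar>f (?T (b *s h) x) * f (?T (b *s k') x) - q h k' x\<bar> \<le> e h k')) \<and>
      (\<Sum>h\<in>S. \<Sum>k'\<in>S. c h * c k' * e h k') < \<epsilon>"
      using W by blast
  qed
qed

text \<open>Group the points of \<open>V\<close> on the line through \<open>v0\<close> parallel to \<open>e\<^sub>k\<close> into one function, which lies in the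
decorrelating class of that line. A generic functional \<open>\<phi>\<close> not involving coordinate \<open>k\<close> separates \<open>v0\<close> from
all points off the line, so that under the shears \<open>t \<mapsto> t + n \<phi>(t) e\<^sub>k\<close> all other functions have a
different speed. The correlation is constant under these shears, and its averages tend to zero.\<close>

theorem correlation_zero:
  assumes "finite V" "V \<noteq> {}"
  shows "expectation (\<lambda>y. \<Prod>v\<in>V. g (T v y)) = 0"
proof -
  obtain v0 where v0: "v0 \<in> V" using assms by blast
  obtain k :: 'd where True by blast
  \<comment> \<open>The position of a point relative to the line through \<open>v0\<close> parallel to \<open>e\<^sub>k\<close>.\<close>
  define flat where "flat v = (\<chi> j. if j = k then 0 else v $ j - v0 $ j)" for v :: "int ^ 'd"
  define V0 where "V0 = {v \<in> V. flat v = 0}"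
  have fin: "finite V0" "finite (V - V0)" using assms by (auto simp: V0_def)
  have v0_V0: "v0 \<in> V0" using v0 by (simp add: V0_def flat_def vec_eq_iff)
  have "\<exists>\<psi> :: int ^ 'd. \<forall>w\<in>flat ` (V - V0). (\<Sum>j\<in>UNIV. \<psi> $ j * w $ j) \<noteq> 0"
    using assms(1) v0 by (intro functional_avoiding_kernels) (auto simp: V0_def)
  then obtain \<psi> :: "int ^ 'd" where \<psi>: "\<And>v. v \<in> V - V0 \<Longrightarrow> (\<Sum>j\<in>UNIV. \<psi> $ j * flat v $ j) \<noteq> 0" by blast
  \<comment> \<open>Deleting coordinate \<open>k\<close> makes the shear unimodular and does not change values on differences of the form \<open>flat v\<close>.\<close>
  define \<phi> where "\<phi> = (\<chi> j. if j = k then 0 else \<psi> $ j)"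
  define a where "a v = (\<Sum>j\<in>UNIV. \<phi> $ j * v $ j)" for v
  have a_diff: "a v - a v0 = (\<Sum>j\<in>UNIV. \<psi> $ j * flat v $ j)" for v
    unfolding a_def sum_subtractf[symmetric]
    by (intro sum.cong refl) (simp add: \<phi>_def flat_def right_diff_distrib)
  have a_V0: "a v = a v0" if "v \<in> V0" for v using a_diff[of v] that by (simp add: V0_def)
  have a_ne: "a v \<noteq> a v0" if "v \<in> V - V0" for v using a_diff[of v] \<psi>[OF that] by simp
  define T' where "T' x = T (axis k (x $ k))" for x :: "int ^ 'd"
  interpret L: lattice_action M T' unfolding T'_def by (rule lattice_action_axis)
  let ?A = "{\<lambda>y. \<Prod>n\<in>S. g (T (v0 + axis k n) y) | S. finite S \<and> S \<noteq> {}}"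
  define f where "f v y = (if v = v0 then \<Prod>v\<in>V0. g (T v y) else g (T v y))" for v y
  have dec: "L.decorrelating ?A"
    using line_monomials_decorrelating[of k v0] unfolding T'_def[abs_def, symmetric] .
  have "f v0 \<in> ?A"
  proof -
    define S where "S = (\<lambda>v. v $ k - v0 $ k) ` V0"
    have line: "v0 + axis k (v $ k - v0 $ k) = v" if "v \<in> V0" for v
      using that by (auto simp: V0_def flat_def vec_eq_iff axis_def) (metis eq_iff_diff_eq_0)
    have "inj_on (\<lambda>v. v $ k - v0 $ k) V0" using line by (rule inj_on_inverseI)
    then have "f v0 = (\<lambda>y. \<Prod>n\<in>S. g (T (v0 + axis k n) y))"
      unfolding f_def S_def by (simp add: prod.reindex line fun_eq_iff)
    moreover have "finite S" "S \<noteq> {}" using fin v0_V0 by (auto simp: S_def)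
    ultimately show ?thesis by blast
  qed
  moreover have "f v \<in> bounded_measurable M" for v
  proof (cases "v = v0")
    case True
    then show ?thesis using monomial_bm[of "\<lambda>v. v" V0] by (simp add: f_def[abs_def])
  next
    case False
    then show ?thesis using bounded_measurable_T[OF g_bm] by (simp add: f_def[abs_def])
  qed
  ultimately have lim: "(\<lambda>N. cube_average N (\<lambda>x. expectation (\<lambda>y. \<Prod>i\<in>insert v0 (V - V0). f i (T' (a i *s x) y)))) \<longlonglongrightarrow> 0"
    using fin a_ne v0_V0 by (intro L.van_der_Corput_average[OF dec, where j = v0]) auto
  have "expectation (\<lambda>y. \<Prod>i\<in>insert v0 (V - V0). f i (T' (a i *s x) y)) = expectation (\<lambda>y. \<Prod>v\<in>V. g (T v y))" for x
  proof -
    define A where "A = shear k ((x $ k) *s \<phi>)"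
    have A: "A *v v = v + axis k (a v * x $ k)" for v
    proof -
      have "(\<Sum>j\<in>UNIV. ((x $ k) *s \<phi>) $ j * v $ j) = a v * x $ k"
        unfolding a_def sum_distrib_right by (intro sum.cong) (simp_all add: mult_ac)
      then show ?thesis unfolding A_def shear_mult by simp
    qed
    have shifted: "T v (T' (a v *s x) y) = T (A *v v) y" if "y \<in> space M" for v y
      unfolding A T'_def using that by (simp add: T_add)
    have "(\<Prod>i\<in>insert v0 (V - V0). f i (T' (a i *s x) y)) = (\<Prod>v\<in>V. g (T (A *v v) y))"
      if y: "y \<in> space M" for y
    proof -
      have "(\<Prod>i\<in>insert v0 (V - V0). f i (T' (a i *s x) y))
          = f v0 (T' (a v0 *s x) y) * (\<Prod>v\<in>V - V0. f v (T' (a v *s x) y))"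
        using fin v0_V0 by simp
      also have "(\<Prod>v\<in>V - V0. f v (T' (a v *s x) y)) = (\<Prod>v\<in>V - V0. g (T (A *v v) y))"
        using v0_V0 shifted[OF y] by (intro prod.cong refl) (auto simp: f_def)
      also have "f v0 (T' (a v0 *s x) y) = (\<Prod>v\<in>V0. g (T (A *v v) y))"
      proof -
        have "g (T v (T' (a v0 *s x) y)) = g (T (A *v v) y)" if "v \<in> V0" for v
          using shifted[OF y, of v] a_V0[OF that] by simp
        then show ?thesis by (simp add: f_def)
      qed
      also have "(\<Prod>v\<in>V0. g (T (A *v v) y)) * (\<Prod>v\<in>V - V0. g (T (A *v v) y)) = (\<Prod>v\<in>V. g (T (A *v v) y))"
      proof -
        have "V0 \<subseteq> V" by (auto simp: V0_def)
        from prod.subset_diff[OF this assms(1), of "\<lambda>v. g (T (A *v v) y)"]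
        show ?thesis by (simp add: mult.commute)
      qed
      finally show ?thesis .
    qed
    then have "expectation (\<lambda>y. \<Prod>i\<in>insert v0 (V - V0). f i (T' (a i *s x) y))
        = expectation (\<lambda>y. \<Prod>v\<in>V. g (T (A *v v) y))"
      by (intro Bochner_Integration.integral_cong refl)
    also have "\<dots> = expectation (\<lambda>y. \<Prod>v\<in>V. g (T v y))"
      unfolding A_def using assms(1) by (intro SL_invariant det_shear) (simp_all add: \<phi>_def)
    finally show ?thesis .
  qed
  then have "(\<lambda>N. cube_average N (\<lambda>x :: int ^ 'd. expectation (\<lambda>y. \<Prod>v\<in>V. g (T v y)))) \<longlonglongrightarrow> 0"
    using lim by simp
  moreover have "\<forall>\<^sub>F N in sequentially. cube_average N (\<lambda>x :: int ^ 'd. expectation (\<lambda>y. \<Prod>v\<in>V. g (T v y)))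
      = expectation (\<lambda>y. \<Prod>v\<in>V. g (T v y))"
    using eventually_gt_at_top[of 0] by eventually_elim (rule cube_average_const)
  ultimately have "(\<lambda>N :: nat. expectation (\<lambda>y. \<Prod>v\<in>V. g (T v y))) \<longlonglongrightarrow> 0"
    by (rule Lim_transform_eventually)
  then show ?thesis by (simp add: LIMSEQ_const_iff)
qed

corollary shifted_product_expectation:
  assumes "finite V"
  shows "expectation (\<lambda>y. \<Prod>v\<in>V. (g (T v y) + p)) = p ^ card V"
proof -
  have "expectation (\<lambda>y. \<Prod>v\<in>V. (g (T v y) + p))
      = expectation (\<lambda>y. \<Sum>W\<in>Pow V. (\<Prod>v\<in>W. g (T v y)) * p ^ card (V - W))"
    using assms by (simp add: prod_add)
  also have "\<dots> = (\<Sum>W\<in>Pow V. expectation (\<lambda>y. \<Prod>v\<in>W. g (T v y)) * p ^ card (V - W))"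
    by (subst Bochner_Integration.integral_sum)
      (simp_all add: bounded_measurable_integrable[OF monomial_bm[of "\<lambda>v. v"]])
  also have "\<dots> = (\<Sum>W\<in>Pow V. if W = {} then p ^ card V else 0)"
    using assms by (intro sum.cong refl) (auto simp: correlation_zero finite_subset prob_space)
  also have "\<dots> = p ^ card V" using assms by (simp add: sum.delta)
  finally show ?thesis .
qed

end

section \<open>The affine group\<close>

lemma affine_map_comp: "affine_map A v \<circ> affine_map B w = affine_map (A ** B) (A *v w + v)"
  by (simp add: affine_map_def fun_eq_iff matrix_vector_mul_assoc[symmetric] matrix_vector_right_distrib add.assoc)

lemma translation_add: "translation (v + w) = translation v \<circ> translation w"
  by (simp add: translation_def affine_map_comp add.commute)

lemma translation_zero: "translation 0 = id"
  by (simp add: translation_def affine_map_def fun_eq_iff)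

text \<open>This relation turns \<open>SL\<^sub>d(\<int>)\<close>-invariance of a function into invariance of the correlations of its
translates.\<close>

lemma linear_conjugates_translation:
  "affine_map A 0 \<circ> translation v = translation (A *v v) \<circ> affine_map A 0"
  by (simp add: translation_def affine_map_comp)

lemma in_ASL:
  "translation v \<in> carrier ASL"
  "det A = 1 \<Longrightarrow> affine_map A 0 \<in> carrier ASL"
  unfolding ASL_def translation_def by auto

locale ASL_action =
  fixes M :: "'a measure" and \<phi> :: "(int ^ 'd \<Rightarrow> int ^ 'd) \<Rightarrow> 'a \<Rightarrow> 'a"
  assumes pmp: "pmp_action ASL M \<phi>"
begin

lemma action_measurable: "h \<in> carrier ASL \<Longrightarrow> \<phi> h \<in> M \<rightarrow>\<^sub>M M"
  and action_distr: "h \<in> carrier ASL \<Longrightarrow> distr M M (\<phi> h) = M"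
  using pmp by (auto simp: pmp_action_def)

sublocale group_action ASL "space M" \<phi>
  using pmp by (simp add: pmp_action_def)

lemma action_comp:
  "\<lbrakk>h \<in> carrier ASL; h' \<in> carrier ASL; x \<in> space M\<rbrakk> \<Longrightarrow> \<phi> (h \<circ> h') x = \<phi> h (\<phi> h' x)"
  using composition_rule[of x h h'] by (simp add: ASL_def)

sublocale lattice_action M "\<lambda>v. \<phi> (translation v)"
proof (intro lattice_action.intro lattice_action_axioms.intro)
  show "prob_space M" using pmp by (simp add: pmp_action_def)
  fix x assume x: "x \<in> space M"
  have "\<phi> \<one>\<^bsub>ASL\<^esub> x = x" unfolding id_eq_one[symmetric] using x by simp
  then show "\<phi> (translation 0) x = x" by (simp add: translation_zero ASL_def)
  show "\<phi> (translation (v + w)) x = \<phi> (translation v) (\<phi> (translation w) x)" for v w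
    using x by (simp add: translation_add action_comp in_ASL)
qed (simp_all add: action_measurable action_distr in_ASL)

lemma SL_invariant_fieldI:
  assumes "CARD('d) \<ge> 3" "weakly_mixing_on (range translation) M \<phi>"
    and U: "U \<in> sets M" "\<forall>h\<in>SL. \<phi> h ` U = U"
  shows "SL_invariant_field M (\<lambda>v. \<phi> (translation v)) (\<lambda>y. indicator U y - prob U)"
proof (unfold_locales)
  let ?T = "\<lambda>v. \<phi> (translation v)" and ?g = "\<lambda>y. indicator U y - prob U"
  show g_bm: "?g \<in> bounded_measurable M"
    using U(1) by (intro bounded_measurable_diff bounded_measurable_const bounded_measurableI[of _ _ 1])
      (auto simp: indicator_def)
  show "expectation ?g = 0" using U(1)
    by (subst Bochner_Integration.integral_diff)
      (auto simp: prob_space intro: integrable_real_indicator emeasure_finite simp: less_top[symmetric])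
  show "CARD('d) \<ge> 3" by fact
  show weakly_mixing
    using assms(2) unfolding weakly_mixing_def lattice_action.ergodic_def[OF lattice_action_diagonal]
      weakly_mixing_on_def ergodic_on_def by blast
  fix A :: "int ^ 'd ^ 'd" and V :: "(int ^ 'd) set"
  assume A: "det A = 1" and "finite V"
  define h where "h = affine_map A 0"
  have h: "h \<in> carrier ASL" "\<phi> h ` U = U" using A U(2) in_ASL by (auto simp: h_def SL_def)
  have g_h: "?g (\<phi> h y) = ?g y" if y: "y \<in> space M" for y
  proof -
    have "\<phi> h y \<in> U \<longleftrightarrow> y \<in> U"
      using h(2) inj_prop[OF h(1)] y sets.sets_into_space[OF U(1)] by (auto dest: inj_onD)
    then show ?thesis by (simp add: indicator_def)
  qed
  have comm: "?T (A *v v) (\<phi> h y) = \<phi> h (?T v y)" if "y \<in> space M" for v y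
    using that h(1) by (simp add: action_comp[symmetric] in_ASL h_def linear_conjugates_translation)
  let ?P = "\<lambda>y. \<Prod>v\<in>V. ?g (?T (A *v v) y)"
  have "?P \<in> bounded_measurable M"
    by (intro bounded_measurable_prod bounded_measurable_T g_bm)
  then have "expectation ?P = expectation (\<lambda>y. ?P (\<phi> h y))"
    using integral_distr[OF action_measurable[OF h(1)] bounded_measurable_measurable]
    by (simp add: action_distr[OF h(1)])
  also have "\<dots> = expectation (\<lambda>y. \<Prod>v\<in>V. ?g (?T v y))"
    by (intro Bochner_Integration.integral_cong refl prod.cong) (simp only: comm g_h T_space)
  finally show "expectation ?P = expectation (\<lambda>y. \<Prod>v\<in>V. ?g (?T v y))" .
qed

end

text \<open>A point lies in the translate \<open>t U\<close> iff its translate by \<open>-t\<close> lies in \<open>U\<close>, so the measure of the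
intersection is an expectation of a product of translated indicators over the set \<open>-F\<close>.\<close>

theorem theorem1p4:
  fixes M :: "'a measure"
    and \<phi> :: "(int ^ 'd \<Rightarrow> int ^ 'd) \<Rightarrow> 'a \<Rightarrow> 'a"
    and U :: "'a set"
    and F :: "(int ^ 'd) set"
  assumes "CARD('d) \<ge> 3"
    and "standard_borel_space M"
    and "pmp_action ASL M \<phi>"
    and "ergodic_on (carrier ASL) M \<phi>"
    and "U \<in> sets M" and "measure M U > 0"
    and "\<forall>g\<in>SL. \<phi> g ` U = U"
    and "weakly_mixing_on (range translation) M \<phi>"
    and "finite F"
  shows "measure M (space M \<inter> (\<Inter>t\<in>F. \<phi> (translation t) ` U)) = measure M U ^ card F"
proof -
  interpret ASL_action M \<phi> by unfold_locales fact
  interpret SL_invariant_field M "\<lambda>v. \<phi> (translation v)" "\<lambda>y. indicator U y - prob U"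
    by (rule SL_invariant_fieldI) fact+
  let ?X = "space M \<inter> (\<Inter>t\<in>F. \<phi> (translation t) ` U)"
  have translate: "y \<in> \<phi> (translation t) ` U \<longleftrightarrow> \<phi> (translation (- t)) y \<in> U" if y: "y \<in> space M" for t y
  proof
    assume "y \<in> \<phi> (translation t) ` U"
    then obtain u where u: "u \<in> U" "y = \<phi> (translation t) u" by blast
    then have "u \<in> space M" using sets.sets_into_space assms(5) by blast
    then have "\<phi> (translation (- t)) y = u" using T_add[of u "- t" t] T_zero u by simp
    then show "\<phi> (translation (- t)) y \<in> U" using u by simp
  next
    assume "\<phi> (translation (- t)) y \<in> U"
    moreover have "y = \<phi> (translation t) (\<phi> (translation (- t)) y)"
      using T_add[OF y, of t "- t"] T_zero[OF y] by simp
    ultimately show "y \<in> \<phi> (translation t) ` U" by blast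
  qed
  have X: "?X = {y \<in> space M. \<forall>t\<in>F. \<phi> (translation (- t)) y \<in> U}" using translate by auto
  have "?X \<in> sets M"
    unfolding X using assms(5,9) by (intro sets.sets_Collect_finite_All) (auto intro: measurable_sets_Collect)
  then have "prob ?X = expectation (indicator ?X)" by simp
  also have "\<dots> = expectation (\<lambda>y. \<Prod>v\<in>uminus ` F. ((indicator U (\<phi> (translation v) y) - prob U) + prob U))"
  proof (intro Bochner_Integration.integral_cong refl)
    fix y assume y: "y \<in> space M"
    have "(\<Prod>v\<in>uminus ` F. ((indicator U (\<phi> (translation v) y) - prob U) + prob U))
        = (\<Prod>t\<in>F. indicator U (\<phi> (translation (- t)) y))"
      by (subst prod.reindex) auto
    also have "\<dots> = indicator ?X y"
      using y assms(9) unfolding X by (auto simp: indicator_def prod_zero_iff)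
    finally show "indicator ?X y = (\<Prod>v\<in>uminus ` F. ((indicator U (\<phi> (translation v) y) - prob U) + prob U))" ..
  qed
  also have "\<dots> = prob U ^ card (uminus ` F)"
    using assms(9) by (intro shifted_product_expectation) simp
  also have "card (uminus ` F) = card F" by (intro card_image) (auto simp: inj_on_def)
  finally show ?thesis .
qed

end
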